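(* Let $1<p<\infty$ with $p\neq2$. There exist trivial isomorphic extensions $\phi_1,\phi_2$ of $K(l^p)$ by $C[0,1]$ that are not equivalent. Moreover, $[\phi_1]\neq[\phi_2]+[\phi_3]$ for every isomorphic extension $\phi_3$ of $K(l^p)$ by $C[0,1]$.
   Context: $\pi:B(l^p)\to B(l^p)/K(l^p)$ is the quotient map. A homomorphism of Banach algebras is an isomorphism (into) if it is bounded above and below by constant multiples of the norm. An isomorphic extension of $K(l^p)$ by $C[0,1]$ is a unital isomorphism (into) $\phi:C[0,1]\to B(l^p)/K(l^p)$; it is trivial if $\phi=\pi\circ\rho$ for a unital isomorphism (into) $\rho:C[0,1]\to B(l^p)$. $\phi_1,\phi_2$ are equivalent if there is an invertible $S\in B(l^p)$ with $\phi_2(a)=\pi(S)\phi_1(a)\pi(S)^{-1}$ for all $a$; $[\phi]$ is the equivalence class, and $[\phi_1]+[\phi_2]$ is the class of $a\mapsto\pi(S_0(T_1\oplus T_2)S_0^{-1})$ where $\pi(T_i)=\phi_i(a)$ and $S_0:l^p\oplus l^p\to l^p$ is any invertible operator. *)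

theory Defs
  imports Complex_Main
begin

(* Scalars are complex. Sequences nat => complex; operators are maps on
   sequences, only their behaviour on l^p matters. *)

type_synonym seq = "nat \<Rightarrow> complex"
type_synonym bop = "seq \<Rightarrow> seq"

definition lp :: "real \<Rightarrow> seq set" where
  "lp p = {x. summable (\<lambda>n. cmod (x n) powr p)}"

definition lpnorm :: "real \<Rightarrow> seq \<Rightarrow> real" where
  "lpnorm p x = (\<Sum>n. cmod (x n) powr p) powr (1 / p)"

definition seq_add :: "seq \<Rightarrow> seq \<Rightarrow> seq" where
  "seq_add x y = (\<lambda>n. x n + y n)"

definition seq_scale :: "complex \<Rightarrow> seq \<Rightarrow> seq" where
  "seq_scale c x = (\<lambda>n. c * x n)"

definition seq_diff :: "seq \<Rightarrow> seq \<Rightarrow> seq" where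
  "seq_diff x y = (\<lambda>n. x n - y n)"

definition bounded_op :: "real \<Rightarrow> bop \<Rightarrow> bool" where
  "bounded_op p T \<longleftrightarrow>
     (\<forall>x\<in>lp p. T x \<in> lp p) \<and>
     (\<forall>x\<in>lp p. \<forall>y\<in>lp p. T (seq_add x y) = seq_add (T x) (T y)) \<and>
     (\<forall>x\<in>lp p. \<forall>c. T (seq_scale c x) = seq_scale c (T x)) \<and>
     (\<exists>M. \<forall>x\<in>lp p. lpnorm p (T x) \<le> M * lpnorm p x)"

definition op_eq :: "real \<Rightarrow> bop \<Rightarrow> bop \<Rightarrow> bool" where
  "op_eq p T S \<longleftrightarrow> (\<forall>x\<in>lp p. T x = S x)"

definition op_add :: "bop \<Rightarrow> bop \<Rightarrow> bop" where
  "op_add T S = (\<lambda>x. seq_add (T x) (S x))"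

definition op_scale :: "complex \<Rightarrow> bop \<Rightarrow> bop" where
  "op_scale c T = (\<lambda>x. seq_scale c (T x))"

definition opnorm :: "real \<Rightarrow> bop \<Rightarrow> real" where
  "opnorm p T = Sup {lpnorm p (T x) | x. x \<in> lp p \<and> lpnorm p x \<le> 1}"

definition compact_op :: "real \<Rightarrow> bop \<Rightarrow> bool" where
  "compact_op p K \<longleftrightarrow> bounded_op p K \<and>
     (\<forall>x :: nat \<Rightarrow> seq. (\<forall>n. x n \<in> lp p \<and> lpnorm p (x n) \<le> 1) \<longrightarrow>
        (\<exists>r y. strict_mono r \<and> y \<in> lp p \<and>
           (\<lambda>n. lpnorm p (seq_diff (K (x (r n))) y)) \<longlonglongrightarrow> 0))"

definition calkin_pi :: "real \<Rightarrow> bop \<Rightarrow> bop set" where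
  "calkin_pi p T = {S. bounded_op p S \<and> compact_op p (\<lambda>x. seq_diff (S x) (T x))}"

definition calkin :: "real \<Rightarrow> bop set set" where
  "calkin p = calkin_pi p ` {T. bounded_op p T}"

definition rep :: "bop set \<Rightarrow> bop" where
  "rep A = (SOME T. T \<in> A)"

definition calkin_norm :: "real \<Rightarrow> bop set \<Rightarrow> real" where
  "calkin_norm p A = Inf (opnorm p ` A)"

definition C01 :: "(real \<Rightarrow> complex) set" where
  "C01 = {f. continuous_on {0..1} f}"

definition supnorm :: "(real \<Rightarrow> complex) \<Rightarrow> real" where
  "supnorm f = Sup ((\<lambda>t. cmod (f t)) ` {0..1})"

definition iso_ext :: "real \<Rightarrow> ((real \<Rightarrow> complex) \<Rightarrow> bop set) \<Rightarrow> bool" where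
  "iso_ext p \<phi> \<longleftrightarrow>
     (\<forall>f\<in>C01. \<phi> f \<in> calkin p) \<and>
     (\<forall>f\<in>C01. \<forall>g\<in>C01. \<phi> (\<lambda>t. f t + g t) = calkin_pi p (op_add (rep (\<phi> f)) (rep (\<phi> g)))) \<and>
     (\<forall>f\<in>C01. \<forall>c. \<phi> (\<lambda>t. c * f t) = calkin_pi p (op_scale c (rep (\<phi> f)))) \<and>
     (\<forall>f\<in>C01. \<forall>g\<in>C01. \<phi> (\<lambda>t. f t * g t) = calkin_pi p (rep (\<phi> f) \<circ> rep (\<phi> g))) \<and>
     \<phi> (\<lambda>t. 1) = calkin_pi p id \<and>
     (\<exists>c C. c > 0 \<and> (\<forall>f\<in>C01. c * supnorm f \<le> calkin_norm p (\<phi> f) \<and>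
                                 calkin_norm p (\<phi> f) \<le> C * supnorm f))"

definition iso_lift :: "real \<Rightarrow> ((real \<Rightarrow> complex) \<Rightarrow> bop) \<Rightarrow> bool" where
  "iso_lift p \<rho> \<longleftrightarrow>
     (\<forall>f\<in>C01. bounded_op p (\<rho> f)) \<and>
     (\<forall>f\<in>C01. \<forall>g\<in>C01. op_eq p (\<rho> (\<lambda>t. f t + g t)) (op_add (\<rho> f) (\<rho> g))) \<and>
     (\<forall>f\<in>C01. \<forall>c. op_eq p (\<rho> (\<lambda>t. c * f t)) (op_scale c (\<rho> f))) \<and>
     (\<forall>f\<in>C01. \<forall>g\<in>C01. op_eq p (\<rho> (\<lambda>t. f t * g t)) (\<rho> f \<circ> \<rho> g)) \<and>
     op_eq p (\<rho> (\<lambda>t. 1)) id \<and>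
     (\<exists>c C. c > 0 \<and> (\<forall>f\<in>C01. c * supnorm f \<le> opnorm p (\<rho> f) \<and>
                                 opnorm p (\<rho> f) \<le> C * supnorm f))"

definition trivial_ext :: "real \<Rightarrow> ((real \<Rightarrow> complex) \<Rightarrow> bop set) \<Rightarrow> bool" where
  "trivial_ext p \<phi> \<longleftrightarrow> iso_ext p \<phi> \<and>
     (\<exists>\<rho>. iso_lift p \<rho> \<and> (\<forall>f\<in>C01. \<phi> f = calkin_pi p (\<rho> f)))"

definition ext_equiv :: "real \<Rightarrow> ((real \<Rightarrow> complex) \<Rightarrow> bop set) \<Rightarrow> ((real \<Rightarrow> complex) \<Rightarrow> bop set) \<Rightarrow> bool" where
  "ext_equiv p \<phi>1 \<phi>2 \<longleftrightarrow>
     (\<exists>S Sinv. bounded_op p S \<and> bounded_op p Sinv \<and>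
        op_eq p (S \<circ> Sinv) id \<and> op_eq p (Sinv \<circ> S) id \<and>
        (\<forall>f\<in>C01. \<phi>2 f = calkin_pi p (S \<circ> rep (\<phi>1 f) \<circ> Sinv)))"

(* S0 (T1 (+) T2) S0^-1 for the interleaving isomorphism
   S0 : l^p (+) l^p -> l^p, S0(u,v) = (u0,v0,u1,v1,...) *)
definition interleave :: "seq \<Rightarrow> seq \<Rightarrow> seq" where
  "interleave u v = (\<lambda>n. if even n then u (n div 2) else v (n div 2))"

definition evens :: "seq \<Rightarrow> seq" where
  "evens x = (\<lambda>n. x (2 * n))"

definition odds :: "seq \<Rightarrow> seq" where
  "odds x = (\<lambda>n. x (2 * n + 1))"

definition op_dsum :: "bop \<Rightarrow> bop \<Rightarrow> bop" where
  "op_dsum T1 T2 = (\<lambda>x. interleave (T1 (evens x)) (T2 (odds x)))"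

definition ext_sum :: "real \<Rightarrow> ((real \<Rightarrow> complex) \<Rightarrow> bop set) \<Rightarrow> ((real \<Rightarrow> complex) \<Rightarrow> bop set) \<Rightarrow> (real \<Rightarrow> complex) \<Rightarrow> bop set" where
  "ext_sum p \<phi>2 \<phi>3 = (\<lambda>f. calkin_pi p (op_dsum (rep (\<phi>2 f)) (rep (\<phi>3 f))))"

end

theory Submission
  imports Defs "HOL-Analysis.Analysis"
begin

text \<open>
  The first extension is diagonal: \<open>f\<close> acts on coordinate \<open>m\<close> by its value at a rational point of
  the unit interval, each point being used infinitely often. The second one exploits the complemented
  Hilbertian subspaces of \<open>l\<^sup>p\<close>: on the dyadic block \<open>{2\<^sup>n..<2\<^sup>n\<^sup>+\<^sup>1}\<close> the function
  \<open>f\<close> multiplies the \<open>i\<close>-th Rademacher function by its value at the \<open>i\<close>-th rational point, and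
  Khintchine's inequality bounds this uniformly in \<open>n\<close>. An equivalence of the diagonal extension with
  the second one, or with a sum having it as a summand, yields an operator \<open>V\<close> that is bounded above
  and below and intertwines the two actions modulo compact operators. Compact operators are small on late
  blocks, so \<open>V\<close> maps \<open>N\<close> Rademacher functions of a late block to nearly disjointly supported
  vectors. The sum of \<open>N\<close> Rademacher functions has norm of order \<open>N\<^sup>1\<^sup>/\<^sup>2\<close>, that of its
  image has order \<open>N\<^sup>1\<^sup>/\<^sup>p\<close>, and these orders differ because \<open>p \<noteq> 2\<close>.
\<close>

section \<open>Rademacher functions on dyadic blocks\<close>

text \<open>Equivalence gives commutation only modulo compact operators. What can be exploited is
  that a compact operator is small on all but finitely many of a sequence of disjointly supported
  unit vectors, so every eigenvalue needs infinitely many disjoint eigenvectors. The order of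
  choices matters: N is fixed first, then continuous bumps, the j-th one equal to 1 at the j-th
  point, then a block so late that all N compact errors fall below a tolerance depending on N. On
  the Rademacher side bump j fixes the j-th Rademacher vector; on the diagonal side it cuts the
  image of that vector down to coordinates that no other bump touches. This is where the near
  disjointness comes from. The argument uses V only through its two norm bounds, never through its
  range, so V may be the restriction of an invertible operator to one summand. That is how an
  arbitrary third extension is covered. Rademacher coefficients are controlled by duality, that is,
  by Khintchine's inequality at the conjugate exponent.\<close>

definition block :: "nat \<Rightarrow> nat set" where
  "block n = {2 ^ n..<2 ^ Suc n}"

text \<open>The number of the block around \<open>m\<close>. Coordinate 0 lies in no block; it gets
  level 0, where Rademacher sums are empty, so formulas that refer to the level make sense there
  too.\<close>

definition level :: "nat \<Rightarrow> nat" where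
  "level m = (LEAST n. m < 2 ^ Suc n)"

text \<open>The bits below n of the members of \<open>block n\<close> run once through all 2^n
  patterns, so for i < n these are independent signs for the counting measure on the block.\<close>

definition rademacher :: "nat \<Rightarrow> nat \<Rightarrow> real" where
  "rademacher i m = (if bit m i then -1 else 1)"

lemma finite_block [simp]: "finite (block n)"
  by (simp add: block_def)

lemma card_block [simp]: "card (block n) = 2 ^ n"
  by (simp add: block_def)

lemma level_block: "m \<in> block n \<Longrightarrow> level m = n"
  unfolding level_def
proof (rule Least_equality)
  fix k
  assume "m \<in> block n" "m < 2 ^ Suc k"
  then have "(2::nat) ^ n < 2 ^ Suc k"
    by (simp add: block_def)
  then show "n \<le> k"
    using power_less_imp_less_exp[of "2::nat" n "Suc k"] by simp
qed (simp add: block_def)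

lemma level_0 [simp]: "level 0 = 0"
  unfolding level_def by (rule Least_equality) auto

lemma block_level:
  assumes "m \<noteq> 0"
  shows "m \<in> block (level m)"
proof -
  have "m < 2 ^ Suc m"
    by (rule Suc_lessD[OF less_exp])
  then have "m < 2 ^ Suc (level m)"
    unfolding level_def by (rule LeastI)
  moreover have "2 ^ level m \<le> m"
  proof (cases "level m")
    case (Suc k)
    then have "\<not> m < 2 ^ Suc k"
      unfolding level_def by (metis lessI not_less_Least)
    then show ?thesis
      using Suc by simp
  qed (use assms in simp)
  ultimately show ?thesis
    by (simp add: block_def)
qed

lemma block_disjoint: "m \<noteq> n \<Longrightarrow> block m \<inter> block n = {}"
  using level_block by blast

lemma lessThan_power2_Suc: "{..<(2::nat) ^ Suc n} = {..<2 ^ n} \<union> block n"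
  unfolding block_def by (rule ivl_disj_un_one(2)[symmetric]) simp

lemma rademacher_mult_self [simp]: "rademacher i m * rademacher i m = 1"
  by (simp add: rademacher_def)

lemma abs_rademacher [simp]: "\<bar>rademacher i m\<bar> = 1"
  by (simp add: rademacher_def)

text \<open>Independence of the bits. Induction removes bit 0: indices are paired as 2m and 2m + 1,
  whose higher bits are those of m.\<close>

lemma sum_prod_bits:
  fixes g :: "nat \<Rightarrow> bool \<Rightarrow> 'a :: comm_semiring_1"
  shows "(\<Sum>k<(2::nat) ^ n. \<Prod>i<n. g i (bit k i)) = (\<Prod>i<n. g i False + g i True)"
proof (induction n arbitrary: g)
  case (Suc n)
  have "(\<Sum>k<(2::nat) ^ Suc n. \<Prod>i<Suc n. g i (bit k i)) =
      (\<Sum>m<(2::nat) ^ n. \<Sum>k\<in>{m * 2..<m * 2 + 2}. \<Prod>i<Suc n. g i (bit k i))"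
    by (subst sum.nat_group) (simp add: mult.commute)
  also have "\<dots> = (\<Sum>m<(2::nat) ^ n. (g 0 False + g 0 True) * (\<Prod>i<n. g (Suc i) (bit m i)))"
  proof (rule sum.cong[OF refl])
    fix m :: nat
    have "{m * 2..<m * 2 + 2} = {m * 2, Suc (m * 2)}"
      by auto
    then show "(\<Sum>k\<in>{m * 2..<m * 2 + 2}. \<Prod>i<Suc n. g i (bit k i)) =
        (g 0 False + g 0 True) * (\<Prod>i<n. g (Suc i) (bit m i))"
      by (simp add: prod.lessThan_Suc_shift bit_Suc bit_0 distrib_right del: prod.lessThan_Suc)
  qed
  also have "\<dots> = (g 0 False + g 0 True) * (\<Prod>i<n. g (Suc i) False + g (Suc i) True)"
    by (simp add: Suc.IH[of "\<lambda>i. g (Suc i)"] flip: sum_distrib_left)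
  finally show ?case
    by (simp add: prod.lessThan_Suc_shift del: prod.lessThan_Suc)
qed simp

lemma bit_add_power2:
  assumes "i < n"
  shows "bit (2 ^ n + k :: nat) i = bit k i"
proof -
  obtain d where n: "n = i + Suc d"
    using assms less_iff_Suc_add by auto
  have "(2 ^ n + k) div 2 ^ i = 2 * 2 ^ d + k div 2 ^ i"
    unfolding n power_add by (simp add: div_plus_div_distrib_dvd_left)
  then show ?thesis
    by (simp add: bit_iff_odd)
qed

lemma sum_block_prod_bits:
  fixes g :: "nat \<Rightarrow> bool \<Rightarrow> 'a :: comm_semiring_1"
  shows "(\<Sum>m\<in>block n. \<Prod>i<n. g i (bit m i)) = (\<Prod>i<n. g i False + g i True)"
proof -
  have "(\<Sum>m\<in>block n. \<Prod>i<n. g i (bit m i)) = (\<Sum>k<(2::nat) ^ n. \<Prod>i<n. g i (bit (2 ^ n + k) i))"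
    unfolding block_def
    by (rule sum.reindex_bij_witness[where i = "\<lambda>k. 2 ^ n + k" and j = "\<lambda>m. m - 2 ^ n"]) auto
  then show ?thesis
    by (simp add: bit_add_power2 sum_prod_bits)
qed

lemma sum_rademacher_mult:
  assumes "i < n" "j < n"
  shows "(\<Sum>m\<in>block n. rademacher i m * rademacher j m) = (if i = j then 2 ^ n else 0)"
proof (cases "i = j")
  case False
  \<comment> \<open>The product of two signs becomes a product over all bit positions; summation
    then makes the factor at position i equal to 1 - 1 = 0.\<close>
  define g :: "nat \<Rightarrow> bool \<Rightarrow> real" where "g l b = (if (l = i \<or> l = j) \<and> b then -1 else 1)" for l b
  have "rademacher i m * rademacher j m = (\<Prod>l<n. g l (bit m l))" for m
  proof -
    have "(\<Prod>l<n. g l (bit m l)) = (\<Prod>l\<in>{i, j}. g l (bit m l))"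
      by (rule prod.mono_neutral_right) (use assms in \<open>auto simp: g_def\<close>)
    then show ?thesis
      using False by (simp add: g_def rademacher_def)
  qed
  then have "(\<Sum>m\<in>block n. rademacher i m * rademacher j m) = (\<Prod>l<n. g l False + g l True)"
    by (simp add: sum_block_prod_bits)
  also have "\<dots> = 0"
    by (rule prod_zero) (use assms in \<open>auto simp: g_def\<close>)
  finally show ?thesis
    using False by simp
qed simp

section \<open>Exponential moments of Rademacher sums\<close>

lemma exp_add_exp_minus_le:
  fixes a :: real
  shows "exp a + exp (- a) \<le> 2 * exp (a\<^sup>2)"
proof -
  have nonneg: "exp b + exp (- b) \<le> 2 * exp (b\<^sup>2)" if "0 \<le> b" for b :: real
  proof (cases "b \<le> 1")
    case True
    have "exp b \<le> 1 + b + b\<^sup>2"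
      using exp_bound[OF that True] .
    moreover have "exp (- b) \<le> 1 - b + b\<^sup>2"
    proof -
      have "1 \<le> (1 - b + b\<^sup>2) * (1 + b)"
        using that by (simp add: algebra_simps power2_eq_square)
      also have "\<dots> \<le> (1 - b + b\<^sup>2) * exp b"
        using True by (intro mult_left_mono exp_ge_add_one_self add_nonneg_nonneg) auto
      finally show ?thesis
        by (simp add: exp_minus field_simps)
    qed
    moreover have "1 + b\<^sup>2 \<le> exp (b\<^sup>2)"
      by (rule exp_ge_add_one_self)
    ultimately show ?thesis
      by linarith
  next
    case False
    then have "b \<le> b\<^sup>2"
      by (simp add: power2_eq_square)
    moreover have "- b \<le> b\<^sup>2"
      using that by (metis neg_le_0_iff_le order_trans zero_le_power2)
    ultimately have "exp b \<le> exp (b\<^sup>2)" "exp (- b) \<le> exp (b\<^sup>2)"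
      by auto
    then show ?thesis
      by linarith
  qed
  show ?thesis
    using nonneg[of a] nonneg[of "- a"] by (cases "0 \<le> a") (auto simp: add.commute)
qed

text \<open>By independence the sum factors into terms 2 cosh (a i), each at most 2 exp ((a i)^2).
  The result is a sub-Gaussian estimate in which only the l2 norm of the coefficients
  appears.\<close>

lemma sum_exp_rademacher_le:
  fixes a :: "nat \<Rightarrow> real"
  shows "(\<Sum>m\<in>block n. exp (\<Sum>i<n. a i * rademacher i m)) \<le> 2 ^ n * exp (\<Sum>i<n. (a i)\<^sup>2)"
proof -
  have "(\<Sum>m\<in>block n. exp (\<Sum>i<n. a i * rademacher i m)) =
      (\<Sum>m\<in>block n. \<Prod>i<n. (\<lambda>i b. exp (a i * (if b then -1 else 1))) i (bit m i))"
    by (simp add: exp_sum rademacher_def)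
  also have "\<dots> = (\<Prod>i<n. exp (a i) + exp (- a i))"
    by (subst sum_block_prod_bits) simp
  also have "\<dots> \<le> (\<Prod>i<n. 2 * exp ((a i)\<^sup>2))"
    by (intro prod_mono) (auto simp: exp_add_exp_minus_le add_nonneg_nonneg)
  finally show ?thesis
    by (simp add: prod.distrib exp_sum)
qed

lemma powr_le_exp:
  fixes s t :: real
  assumes "0 < s" "0 \<le> t"
  shows "t powr s \<le> s powr s * exp t"
proof -
  have "t / s \<le> exp (t / s)"
    using exp_ge_add_one_self[of "t / s"] by linarith
  then have "(t / s) powr s \<le> exp (t / s) powr s"
    using assms by (intro powr_mono2) auto
  then have "t powr s / s powr s \<le> exp t"
    using assms by (simp add: powr_divide exp_powr_real)
  then show ?thesis
    using assms by (simp add: field_simps)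
qed

section \<open>Khintchine's inequality\<close>

text \<open>After scaling the coefficients to l2 norm 1, the bound t^s <= s^s exp t reduces the
  moment to the exponential sums of S and of -S, each at most 2^n e. This is the origin of the
  constant 2 s^s e.\<close>

lemma khintchine_real:
  fixes a :: "nat \<Rightarrow> real"
  assumes "0 < s"
  shows "(\<Sum>m\<in>block n. \<bar>\<Sum>i<n. a i * rademacher i m\<bar> powr s) \<le>
    2 * s powr s * exp 1 * 2 ^ n * (\<Sum>i<n. (a i)\<^sup>2) powr (s / 2)"
proof (cases "(\<Sum>i<n. (a i)\<^sup>2) = 0")
  case True
  then have "a i = 0" if "i < n" for i
    using that by (simp add: sum_nonneg_eq_0_iff)
  then have "(\<Sum>m\<in>block n. \<bar>\<Sum>i<n. a i * rademacher i m\<bar> powr s) = 0"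
    by simp
  then show ?thesis
    by (simp add: True)
next
  case False
  define L where "L = sqrt (\<Sum>i<n. (a i)\<^sup>2)"
  have pos: "0 < (\<Sum>i<n. (a i)\<^sup>2)"
    using False by (simp add: less_le sum_nonneg)
  have L: "0 < L" "L\<^sup>2 = (\<Sum>i<n. (a i)\<^sup>2)"
    using pos by (auto simp: L_def)
  have L_powr: "L powr s = (\<Sum>i<n. (a i)\<^sup>2) powr (s / 2)"
    using pos by (simp add: L_def powr_powr flip: powr_half_sqrt)
  define b where "b i = a i / L" for i
  have b: "(\<Sum>i<n. (b i)\<^sup>2) = 1"
    using L pos by (simp add: b_def power_divide flip: sum_divide_distrib)
  define S where "S m = (\<Sum>i<n. b i * rademacher i m)" for m
  have "(\<Sum>i<n. a i * rademacher i m) = L * S m" for m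
    using L(1) by (simp add: S_def b_def sum_distrib_left)
  then have scaled: "(\<Sum>m\<in>block n. \<bar>\<Sum>i<n. a i * rademacher i m\<bar> powr s) = L powr s * (\<Sum>m\<in>block n. \<bar>S m\<bar> powr s)"
    using L(1) by (simp add: abs_mult powr_mult sum_distrib_left)
  have "(\<Sum>m\<in>block n. \<bar>S m\<bar> powr s) \<le> (\<Sum>m\<in>block n. s powr s * (exp (S m) + exp (- S m)))"
  proof (rule sum_mono)
    fix m
    have "exp \<bar>S m\<bar> \<le> exp (S m) + exp (- S m)"
      by (cases "0 \<le> S m") auto
    then show "\<bar>S m\<bar> powr s \<le> s powr s * (exp (S m) + exp (- S m))"
      using powr_le_exp[OF assms, of "\<bar>S m\<bar>"] mult_left_mono[of _ _ "s powr s"] by fastforce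
  qed
  also have "\<dots> = s powr s * ((\<Sum>m\<in>block n. exp (S m)) + (\<Sum>m\<in>block n. exp (- S m)))"
    by (simp add: sum.distrib flip: sum_distrib_left)
  also have "\<dots> \<le> s powr s * (2 ^ n * exp 1 + 2 ^ n * exp 1)"
    using sum_exp_rademacher_le[of b n] sum_exp_rademacher_le[of "\<lambda>i. - b i" n] b
    by (intro mult_left_mono add_mono) (auto simp: S_def sum_negf)
  finally have "(\<Sum>m\<in>block n. \<bar>S m\<bar> powr s) \<le> 2 * s powr s * exp 1 * 2 ^ n"
    by (simp add: algebra_simps)
  from mult_left_mono[OF this, of "L powr s"] show ?thesis
    by (simp add: scaled L_powr mult_ac)
qed

lemma cmod_powr_le:
  assumes "0 < s"
  shows "cmod z powr s \<le> 2 powr s * (\<bar>Re z\<bar> powr s + \<bar>Im z\<bar> powr s)"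
proof -
  have "cmod z powr s \<le> (2 * max \<bar>Re z\<bar> \<bar>Im z\<bar>) powr s"
    using assms cmod_le[of z] by (intro powr_mono2) auto
  also have "\<dots> = 2 powr s * (max \<bar>Re z\<bar> \<bar>Im z\<bar>) powr s"
    by (simp add: powr_mult)
  also have "\<dots> \<le> 2 powr s * (\<bar>Re z\<bar> powr s + \<bar>Im z\<bar> powr s)"
    by (intro mult_left_mono) (auto simp: max_def)
  finally show ?thesis .
qed

lemma khintchine:
  assumes "0 < s"
  shows "\<exists>K>0. \<forall>n (a :: nat \<Rightarrow> complex).
    (\<Sum>m\<in>block n. cmod (\<Sum>i<n. a i * rademacher i m) powr s) \<le>
    K * 2 ^ n * (\<Sum>i<n. (cmod (a i))\<^sup>2) powr (s / 2)"
proof (intro exI conjI allI)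
  define K where "K = 2 * s powr s * exp (1::real)"
  show "0 < 2 powr s * (2 * K)"
    using assms by (simp add: K_def)
  fix n and a :: "nat \<Rightarrow> complex"
  let ?A = "(\<Sum>i<n. (cmod (a i))\<^sup>2) powr (s / 2)"
  have part: "(\<Sum>m\<in>block n. \<bar>\<Sum>i<n. b i * rademacher i m\<bar> powr s) \<le> K * 2 ^ n * ?A"
    if "\<And>i. \<bar>b i\<bar> \<le> cmod (a i)" for b
  proof -
    have "(\<Sum>i<n. (b i)\<^sup>2) \<le> (\<Sum>i<n. (cmod (a i))\<^sup>2)"
      using that by (intro sum_mono) (metis abs_ge_zero power2_abs power_mono)
    then have "(\<Sum>i<n. (b i)\<^sup>2) powr (s / 2) \<le> ?A"
      using assms by (intro powr_mono2) (auto intro: sum_nonneg)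
    then have "K * 2 ^ n * (\<Sum>i<n. (b i)\<^sup>2) powr (s / 2) \<le> K * 2 ^ n * ?A"
      by (intro mult_left_mono) (auto simp: K_def)
    then show ?thesis
      using khintchine_real[OF assms, of b n] unfolding K_def by linarith
  qed
  have "(\<Sum>m\<in>block n. cmod (\<Sum>i<n. a i * rademacher i m) powr s) \<le>
      (\<Sum>m\<in>block n. 2 powr s * (\<bar>\<Sum>i<n. Re (a i) * rademacher i m\<bar> powr s +
        \<bar>\<Sum>i<n. Im (a i) * rademacher i m\<bar> powr s))"
    using cmod_powr_le[OF assms, of "\<Sum>i<n. a i * rademacher i m" for m]
    by (intro sum_mono) simp
  also have "\<dots> = 2 powr s * ((\<Sum>m\<in>block n. \<bar>\<Sum>i<n. Re (a i) * rademacher i m\<bar> powr s) +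
      (\<Sum>m\<in>block n. \<bar>\<Sum>i<n. Im (a i) * rademacher i m\<bar> powr s))"
    by (simp add: sum.distrib flip: sum_distrib_left)
  also have "\<dots> \<le> 2 powr s * (K * 2 ^ n * ?A + K * 2 ^ n * ?A)"
    by (intro mult_left_mono add_mono part abs_Re_le_cmod abs_Im_le_cmod) simp
  finally show "(\<Sum>m\<in>block n. cmod (\<Sum>i<n. a i * rademacher i m) powr s) \<le>
      2 powr s * (2 * K) * 2 ^ n * ?A"
    by (simp add: algebra_simps)
qed

section \<open>Hoelder's inequality and the dual estimate for Rademacher coefficients\<close>

lemma Holder_sum:
  fixes u v :: "'a \<Rightarrow> real"
  assumes "1 < p" "1 < q" "1 / p + 1 / q = 1" "finite A"
    and "\<And>i. i \<in> A \<Longrightarrow> 0 \<le> u i" "\<And>i. i \<in> A \<Longrightarrow> 0 \<le> v i"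
  shows "(\<Sum>i\<in>A. u i * v i) \<le> (\<Sum>i\<in>A. u i powr p) powr (1 / p) * (\<Sum>i\<in>A. v i powr q) powr (1 / q)"
proof (cases "(\<Sum>i\<in>A. u i powr p) = 0 \<or> (\<Sum>i\<in>A. v i powr q) = 0")
  case True
  then have "u i * v i = 0" if "i \<in> A" for i
    using assms(4) that by (auto simp: sum_nonneg_eq_0_iff)
  then have "(\<Sum>i\<in>A. u i * v i) = 0"
    by (rule sum.neutral[rule_format])
  then show ?thesis
    by simp
next
  case False
  define U where "U = (\<Sum>i\<in>A. u i powr p) powr (1 / p)"
  define V where "V = (\<Sum>i\<in>A. v i powr q) powr (1 / q)"
  have pos: "0 < (\<Sum>i\<in>A. u i powr p)" "0 < (\<Sum>i\<in>A. v i powr q)"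
    using False by (auto simp: less_le intro: sum_nonneg)
  then have UV: "0 < U" "0 < V" "U powr p = (\<Sum>i\<in>A. u i powr p)" "V powr q = (\<Sum>i\<in>A. v i powr q)"
    using assms False by (auto simp: U_def V_def powr_powr)
  \<comment> \<open>With both factors normalised, Young's inequality applies termwise, and the
    bounds add up to 1/p + 1/q = 1.\<close>
  have "(\<Sum>i\<in>A. u i * v i) / (U * V) = (\<Sum>i\<in>A. u i / U * (v i / V))"
    by (simp add: sum_divide_distrib)
  also have "\<dots> \<le> (\<Sum>i\<in>A. (u i / U) powr p / p + (v i / V) powr q / q)"
    using assms UV by (intro sum_mono Youngs_inequality) auto
  also have "\<dots> = (\<Sum>i\<in>A. (u i / U) powr p) / p + (\<Sum>i\<in>A. (v i / V) powr q) / q"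
    by (simp add: sum.distrib sum_divide_distrib)
  also have "(\<Sum>i\<in>A. (u i / U) powr p) = (\<Sum>i\<in>A. u i powr p / U powr p)"
    using assms UV by (intro sum.cong) (auto simp: powr_divide)
  also have "\<dots> = 1"
    using pos UV(3) by (simp flip: sum_divide_distrib)
  also have "(\<Sum>i\<in>A. (v i / V) powr q) = (\<Sum>i\<in>A. v i powr q / V powr q)"
    using assms UV by (intro sum.cong) (auto simp: powr_divide)
  also have "\<dots> = 1"
    using pos UV(4) by (simp flip: sum_divide_distrib)
  finally show ?thesis
    using assms(3) UV by (simp add: U_def[symmetric] V_def[symmetric] field_simps)
qed

text \<open>The inner product with the i-th Rademacher function, divided by the size 2^n of the
  block so that it reads off the coefficients of a Rademacher sum.\<close>

definition rcoef :: "nat \<Rightarrow> nat \<Rightarrow> seq \<Rightarrow> complex" where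
  "rcoef n i x = (\<Sum>m\<in>block n. x m * rademacher i m) / 2 ^ n"

text \<open>The dual of Khintchine's inequality. The sum of squares S is the pairing of x with the
  Rademacher sum whose coefficients are the conjugates, divided by 2^n. Hoelder bounds it by the lp
  norm of x times the lq norm of that sum, and Khintchine at exponent q turns the latter into a
  multiple of S^(1/2), which cancels. The remaining factor 1 / 2^n is the inverse of the one in
  Khintchine at exponent p.\<close>

lemma sum_rcoef_le:
  assumes "1 < p"
  shows "\<exists>K>0. \<forall>n x. (\<Sum>i<n. (cmod (rcoef n i x))\<^sup>2) powr (p / 2) \<le>
    K / 2 ^ n * (\<Sum>m\<in>block n. cmod (x m) powr p)"
proof -
  define q where "q = p / (p - 1)"
  have q: "1 < q" "1 / p + 1 / q = 1"
    using assms by (auto simp: q_def field_simps)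
  obtain K where K: "0 < K" "\<And>n (a :: nat \<Rightarrow> complex).
    (\<Sum>m\<in>block n. cmod (\<Sum>i<n. a i * rademacher i m) powr q) \<le>
    K * 2 ^ n * (\<Sum>i<n. (cmod (a i))\<^sup>2) powr (q / 2)"
    using khintchine[of q] q(1) by auto
  have "(\<Sum>i<n. (cmod (rcoef n i x))\<^sup>2) powr (p / 2) \<le>
    K powr (p / q) / 2 ^ n * (\<Sum>m\<in>block n. cmod (x m) powr p)" for n x
  proof (cases "(\<Sum>i<n. (cmod (rcoef n i x))\<^sup>2) = 0")
    case False
    define S where "S = (\<Sum>i<n. (cmod (rcoef n i x))\<^sup>2)"
    define X where "X = (\<Sum>m\<in>block n. cmod (x m) powr p)"
    define a where "a i = cnj (rcoef n i x)" for i
    have S: "0 < S"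
      using False by (simp add: S_def less_le sum_nonneg)
    have X: "0 \<le> X"
      by (simp add: X_def sum_nonneg)
    have "complex_of_real S = (\<Sum>i<n. a i * rcoef n i x)"
      unfolding S_def a_def of_real_sum complex_norm_square by (simp add: mult.commute)
    also have "\<dots> = (\<Sum>i<n. \<Sum>m\<in>block n. x m * (a i * rademacher i m)) / 2 ^ n"
      by (simp add: rcoef_def sum_distrib_left sum_divide_distrib mult_ac)
    also have "\<dots> = (\<Sum>m\<in>block n. x m * (\<Sum>i<n. a i * rademacher i m)) / 2 ^ n"
      by (subst sum.swap) (simp add: sum_distrib_left)
    finally have "S = cmod ((\<Sum>m\<in>block n. x m * (\<Sum>i<n. a i * rademacher i m)) / 2 ^ n)"
      using S by (metis abs_of_pos norm_of_real)
    also have "\<dots> \<le> (\<Sum>m\<in>block n. cmod (x m) * cmod (\<Sum>i<n. a i * rademacher i m)) / 2 ^ n"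
      by (simp add: norm_divide norm_power divide_right_mono sum_norm_le norm_mult)
    also have "\<dots> \<le> X powr (1 / p) * (\<Sum>m\<in>block n. cmod (\<Sum>i<n. a i * rademacher i m) powr q) powr (1 / q) / 2 ^ n"
      unfolding X_def using assms q by (intro divide_right_mono Holder_sum) auto
    also have "\<dots> \<le> X powr (1 / p) * (K * 2 ^ n * S powr (q / 2)) powr (1 / q) / 2 ^ n"
      using K(2)[where a = a and n = n] q
      by (intro divide_right_mono mult_left_mono powr_mono2) (auto simp: S_def a_def sum_nonneg)
    also have "(K * 2 ^ n * S powr (q / 2)) powr (1 / q) = K powr (1 / q) * (2 ^ n) powr (1 / q) * S powr (1 / 2)"
      using K(1) q S by (simp add: powr_mult powr_powr)
    finally have "S powr (1 / 2) * S powr (1 / 2) \<le>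
        X powr (1 / p) * (K powr (1 / q) * ((2 ^ n) powr (1 / q) / 2 ^ n)) * S powr (1 / 2)"
      using S by (simp add: powr_half_sqrt)
    then have "S powr (1 / 2) \<le> X powr (1 / p) * (K powr (1 / q) * ((2 ^ n) powr (1 / q) / 2 ^ n))"
      by (rule mult_right_le_imp_le) (use S in simp)
    also have "(2 ^ n) powr (1 / q) / 2 ^ n = ((2::real) ^ n) powr (- (1 / p))"
    proof -
      have "- (1 / p) = 1 / q - 1"
        using q(2) by simp
      then show ?thesis
        by (simp add: powr_diff)
    qed
    finally have "(S powr (1 / 2)) powr p \<le> (X powr (1 / p) * (K powr (1 / q) * (2 ^ n) powr (- (1 / p)))) powr p"
      using assms by (intro powr_mono2) auto
    also have "\<dots> = X * (K powr (p / q) * (2 ^ n) powr (- 1))"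
      using assms X K(1) by (simp add: powr_mult powr_powr)
    also have "\<dots> = K powr (p / q) / 2 ^ n * X"
      by (simp add: powr_minus field_simps)
    finally show ?thesis
      by (simp add: S_def X_def powr_powr)
  qed (use assms in \<open>simp add: sum_nonneg\<close>)
  then show ?thesis
    using K(1) by (intro exI[of _ "K powr (p / q)"]) auto
qed

section \<open>Diagonal and Rademacher multipliers\<close>

text \<open>The pairing function lets \<open>c i\<close> act on the infinitely many coordinates
  \<open>prod_encode (i, n)\<close>.\<close>

definition diag_op :: "(nat \<Rightarrow> complex) \<Rightarrow> bop" where
  "diag_op c x = (\<lambda>m. c (fst (prod_decode m)) * x m)"

definition rad_part :: "(nat \<Rightarrow> complex) \<Rightarrow> bop" where
  "rad_part c x = (\<lambda>m. \<Sum>i<level m. c i * rcoef (level m) i x * rademacher i m)"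

text \<open>Multiplication by \<open>c i\<close> on the \<open>i\<close>-th Rademacher function of each block, and by \<open>c 0\<close> on the
  kernel of the Rademacher projection.\<close>

definition rad_op :: "(nat \<Rightarrow> complex) \<Rightarrow> bop" where
  "rad_op c x = seq_add (seq_scale (c 0) x) (rad_part (\<lambda>i. c i - c 0) x)"

text \<open>The block has 2^n entries, so the divisor 2^(n/p) makes the lp norm equal to 1.\<close>

definition rvec :: "real \<Rightarrow> nat \<Rightarrow> nat \<Rightarrow> seq" where
  "rvec p n i = (\<lambda>m. if m \<in> block n then rademacher i m / 2 powr (n / p) else 0)"

lemma rcoef_expansion:
  fixes b :: "nat \<Rightarrow> complex"
  assumes "i < n" "\<And>m. m \<in> block n \<Longrightarrow> x m = (\<Sum>j<n. b j * rademacher j m)"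
  shows "rcoef n i x = b i"
proof -
  have "(\<Sum>m\<in>block n. x m * rademacher i m) =
      (\<Sum>m\<in>block n. \<Sum>j<n. b j * complex_of_real (rademacher j m * rademacher i m))"
    by (simp add: assms(2) sum_distrib_right mult.assoc)
  also have "\<dots> = (\<Sum>j<n. b j * complex_of_real (\<Sum>m\<in>block n. rademacher j m * rademacher i m))"
    by (subst sum.swap) (simp add: sum_distrib_left)
  also have "\<dots> = (\<Sum>j<n. if j = i then b j * 2 ^ n else 0)"
    using assms(1) by (intro sum.cong) (auto simp: sum_rademacher_mult simp del: of_real_sum)
  finally show ?thesis
    using assms(1) by (simp add: rcoef_def)
qed

lemma rcoef_add: "rcoef n i (seq_add x y) = rcoef n i x + rcoef n i y"
  by (simp add: rcoef_def seq_add_def sum.distrib distrib_right add_divide_distrib)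

lemma rcoef_scale: "rcoef n i (seq_scale c x) = c * rcoef n i x"
  by (simp add: rcoef_def seq_scale_def mult.assoc flip: sum_distrib_left)

lemma rcoef_rad_op:
  assumes "i < n"
  shows "rcoef n i (rad_op c x) = c i * rcoef n i x"
proof -
  have "rcoef n i (rad_part (\<lambda>i. c i - c 0) x) = (c i - c 0) * rcoef n i x"
    by (rule rcoef_expansion[OF assms, where b = "\<lambda>i. (c i - c 0) * rcoef n i x"])
      (simp add: rad_part_def level_block)
  then show ?thesis
    by (simp add: rad_op_def rcoef_add rcoef_scale algebra_simps)
qed

text \<open>With P_i the i-th Rademacher projection on a block, \<open>rad_op c\<close> is c 0 + sum
  (c i - c 0) P_i. Orthogonality makes the i-th coefficient of \<open>rad_op d x\<close> equal to d
  i times that of x, and c 0 (d i - d 0) + (c i - c 0) d i = c i d i - c 0 d 0.\<close>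

lemma rad_op_mult: "rad_op (\<lambda>i. c i * d i) x = rad_op c (rad_op d x)"
proof
  fix m
  have "rad_op c (rad_op d x) m = c 0 * rad_op d x m +
      (\<Sum>i<level m. (c i - c 0) * (d i * rcoef (level m) i x) * rademacher i m)"
    unfolding rad_op_def[of c] by (simp add: seq_add_def seq_scale_def rad_part_def rcoef_rad_op)
  also have "c 0 * rad_op d x m = c 0 * d 0 * x m +
      (\<Sum>i<level m. c 0 * (d i - d 0) * rcoef (level m) i x * rademacher i m)"
    by (simp add: rad_op_def seq_add_def seq_scale_def rad_part_def distrib_left sum_distrib_left mult_ac)
  finally show "rad_op (\<lambda>i. c i * d i) x m = rad_op c (rad_op d x) m"
    by (simp add: rad_op_def seq_add_def seq_scale_def rad_part_def algebra_simps flip: sum.distrib)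
qed

lemma rad_op_add: "rad_op (\<lambda>i. c i + d i) x = seq_add (rad_op c x) (rad_op d x)"
  by (auto simp: rad_op_def seq_add_def seq_scale_def rad_part_def algebra_simps simp flip: sum.distrib)

lemma rad_op_scale: "rad_op (\<lambda>i. a * c i) x = seq_scale a (rad_op c x)"
  by (auto simp: rad_op_def seq_add_def seq_scale_def rad_part_def algebra_simps sum_distrib_left)

lemma rad_op_one: "rad_op (\<lambda>i. 1) x = x"
  by (simp add: rad_op_def seq_add_def seq_scale_def rad_part_def)

lemma rad_op_seq_add: "rad_op c (seq_add x y) = seq_add (rad_op c x) (rad_op c y)"
  by (auto simp: rad_op_def rad_part_def rcoef_add)
    (auto simp: seq_add_def seq_scale_def algebra_simps simp flip: sum.distrib)

lemma rad_op_seq_scale: "rad_op c (seq_scale a x) = seq_scale a (rad_op c x)"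
  by (auto simp: rad_op_def rad_part_def rcoef_scale)
    (auto simp: seq_add_def seq_scale_def algebra_simps sum_distrib_left)

lemma rad_op_rvec:
  assumes "i < n"
  shows "rad_op c (rvec p n i) = seq_scale (c i) (rvec p n i)"
proof
  fix m
  show "rad_op c (rvec p n i) m = seq_scale (c i) (rvec p n i) m"
  proof (cases "m \<in> block n")
    case True
    define b :: "nat \<Rightarrow> complex" where "b j = (if j = i then 1 / 2 powr (n / p) else 0)" for j
    have "rcoef n j (rvec p n i) = b j" if "j < n" for j
    proof (rule rcoef_expansion[OF that])
      fix m
      assume "m \<in> block n"
      have "(\<Sum>j<n. b j * rademacher j m) = (\<Sum>j<n. if j = i then b i * rademacher i m else 0)"
        by (intro sum.cong) (auto simp: b_def)
      then show "rvec p n i m = (\<Sum>j<n. b j * rademacher j m)"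
        using assms \<open>m \<in> block n\<close> by (simp add: rvec_def b_def)
    qed
    then have "rad_part (\<lambda>i. c i - c 0) (rvec p n i) m =
        (\<Sum>j<n. if j = i then (c i - c 0) * rvec p n i m else 0)"
      unfolding rad_part_def level_block[OF True] using True by (intro sum.cong) (auto simp: rvec_def b_def)
    then show ?thesis
      using assms by (simp add: rad_op_def seq_add_def seq_scale_def algebra_simps)
  next
    case False
    have "rcoef (level m) j (rvec p n i) = 0" if "j < level m" for j
    proof -
      have "block (level m) \<inter> block n = {}"
      proof (rule block_disjoint, rule notI)
        assume "level m = n"
        moreover have "m \<noteq> 0"
          using that by (metis level_0 not_less_zero)
        ultimately show False
          using False block_level by blast
      qed
      then show ?thesis
        unfolding rcoef_def rvec_def by (auto intro!: sum.neutral)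
    qed
    then show ?thesis
      using False by (simp add: rad_op_def seq_add_def seq_scale_def rad_part_def rvec_def)
  qed
qed

section \<open>Rational points of the unit interval\<close>

text \<open>Density of the points makes them norming for continuous functions; that they are
  enumerated without repetition allows bumps to separate them.\<close>

definition rat_pt :: "nat \<Rightarrow> real" where
  "rat_pt = from_nat_into (\<rat> \<inter> {0..1})"

lemma bij_rat_pt: "bij_betw rat_pt UNIV (\<rat> \<inter> {0..1})"
  unfolding rat_pt_def
proof (rule bij_betw_from_nat_into)
  show "countable (\<rat> \<inter> {0..1::real})"
    using countable_rat by (rule countable_subset[rotated]) simp
  have "inj (\<lambda>n. 1 / real (Suc n))"
    by (auto simp: inj_on_def)
  then have "infinite (range (\<lambda>n. 1 / real (Suc n)))"
    by (rule range_inj_infinite)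
  moreover have "range (\<lambda>n. 1 / real (Suc n)) \<subseteq> \<rat> \<inter> {0..1}"
    by (auto simp: Rats_divide simp del: of_nat_Suc)
  ultimately show "infinite (\<rat> \<inter> {0..1::real})"
    using infinite_super by blast
qed

lemma rat_pt_mem: "rat_pt i \<in> {0..1}"
  using bij_rat_pt by (auto simp: bij_betw_def)

lemma inj_rat_pt: "inj rat_pt"
  using bij_rat_pt by (simp add: bij_betw_def)

lemma closure_rat_Icc: "closure (\<rat> \<inter> {0..1::real}) = {0..1}"
proof
  show "closure (\<rat> \<inter> {0..1::real}) \<subseteq> {0..1}"
    by (rule closure_minimal) auto
  show "{0..1::real} \<subseteq> closure (\<rat> \<inter> {0..1})"
  proof
    fix t :: real
    assume t: "t \<in> {0..1}"
    show "t \<in> closure (\<rat> \<inter> {0..1})"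
      unfolding closure_approachable
    proof (intro allI impI)
      fix e :: real
      assume "0 < e"
      then have "max 0 (t - e) < min 1 (t + e)"
        using t by auto
      then obtain r where "r \<in> \<rat>" "max 0 (t - e) < r" "r < min 1 (t + e)"
        using Rats_dense_in_real by blast
      then show "\<exists>y\<in>\<rat> \<inter> {0..1}. dist y t < e"
        by (intro bexI[of _ r]) (auto simp: dist_real_def)
    qed
  qed
qed

lemma supnorm_le_rat_pt:
  assumes "f \<in> C01" "\<And>i. cmod (f (rat_pt i)) \<le> B"
  shows "supnorm f \<le> B"
proof -
  have "cmod (f t) \<le> B" if "t \<in> {0..1}" for t
  proof (rule continuous_on_closure_norm_le[of "\<rat> \<inter> {0..1}" f B t])
    show "continuous_on (closure (\<rat> \<inter> {0..1})) f"
      using assms(1) by (simp add: C01_def closure_rat_Icc)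
    show "\<forall>y\<in>(\<rat> \<inter> {0..1}). cmod (f y) \<le> B"
      using assms(2) bij_rat_pt by (metis bij_betw_imp_surj_on rangeE)
    show "t \<in> closure (\<rat> \<inter> {0..1})"
      using that by (simp add: closure_rat_Icc)
  qed
  then show ?thesis
    unfolding supnorm_def by (intro cSup_least) auto
qed

text \<open>Tents around the points, too narrow to overlap. Under a diagonal action such functions
  cut vectors down to disjoint sets of coordinates.\<close>

lemma disjoint_bumps:
  fixes t :: "nat \<Rightarrow> real"
  assumes "inj t"
  shows "\<exists>f. (\<forall>j<N. f j \<in> C01 \<and> f j (t j) = 1) \<and>
    (\<forall>j<N. \<forall>k<N. j \<noteq> k \<longrightarrow> (\<forall>s. f j s = 0 \<or> f k s = 0))"
proof -
  define P where "P = {(j, k). j < N \<and> k < N \<and> j \<noteq> k}"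
  \<comment> \<open>The extra element 1 keeps the set nonempty when there are fewer than two
    points.\<close>
  define D where "D = insert 1 ((\<lambda>(j, k). \<bar>t j - t k\<bar>) ` P)"
  define d where "d = Min D"
  have "finite P"
    by (rule finite_subset[of _ "{..<N} \<times> {..<N}"]) (auto simp: P_def)
  then have fin: "finite D"
    by (simp add: D_def)
  have "x > 0" if "x \<in> D" for x
    using that assms by (auto simp: D_def P_def dest: injD)
  then have d: "0 < d"
    unfolding d_def using fin by (subst Min_gr_iff) (auto simp: D_def)
  have sep: "d \<le> \<bar>t j - t k\<bar>" if "j < N" "k < N" "j \<noteq> k" for j k
    unfolding d_def using fin that by (intro Min_le) (auto simp: D_def P_def)
  \<comment> \<open>Each tent has half-width d / 2, and distinct centres are at least d apart, so no
    two tents are nonzero at a common point.\<close>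
  define f :: "nat \<Rightarrow> real \<Rightarrow> complex" where "f j s = of_real (max 0 (1 - 2 * \<bar>s - t j\<bar> / d))" for j s
  have "f j \<in> C01" "f j (t j) = 1" for j
    using d by (auto simp: C01_def f_def intro!: continuous_intros)
  moreover have "f j s = 0 \<or> f k s = 0" if "j < N" "k < N" "j \<noteq> k" for j k s
  proof (rule ccontr)
    assume "\<not> (f j s = 0 \<or> f k s = 0)"
    then have "0 < 1 - 2 * \<bar>s - t j\<bar> / d" "0 < 1 - 2 * \<bar>s - t k\<bar> / d"
      unfolding f_def by (metis max.absorb1 not_le of_real_0)+
    then have "2 * \<bar>s - t j\<bar> < d" "2 * \<bar>s - t k\<bar> < d"
      using d by (auto simp: field_simps)
    moreover have "\<bar>t j - t k\<bar> \<le> \<bar>s - t k\<bar> + \<bar>s - t j\<bar>"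
      using abs_triangle_ineq4[of "s - t k" "s - t j"] by simp
    ultimately show False
      using sep[OF that] by (smt (verit))
  qed
  ultimately show ?thesis
    by blast
qed

lemma cmod_le_supnorm:
  assumes "f \<in> C01" "t \<in> {0..1}"
  shows "cmod (f t) \<le> supnorm f"
proof -
  have "compact ((\<lambda>t. cmod (f t)) ` {0..1})"
    using assms(1) by (intro compact_continuous_image continuous_on_norm) (auto simp: C01_def)
  then show ?thesis
    unfolding supnorm_def using assms(2)
    by (intro cSup_upper) (auto dest: compact_imp_bounded bounded_imp_bdd_above)
qed

section \<open>The sequence space\<close>

text \<open>For positive arguments this is convexity of the power; if one argument is 0 it reduces
  to (k w)^p <= k w^p for 0 <= k <= 1.\<close>

lemma powr_convex_comb:
  fixes u v l p :: real
  assumes "1 \<le> p" "0 \<le> u" "0 \<le> v" "0 \<le> l" "l \<le> 1"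
  shows "(l * u + (1 - l) * v) powr p \<le> l * u powr p + (1 - l) * v powr p"
proof -
  have shrink: "(k * w) powr p \<le> k * w powr p" if "0 \<le> k" "k \<le> 1" "0 \<le> w" for k w :: real
  proof -
    have "k powr p \<le> k"
    proof (cases "k = 0")
      case False
      then show ?thesis
        using powr_mono'[of 1 p k] that assms by simp
    qed (use assms in simp)
    then show ?thesis
      using that by (simp add: powr_mult mult_right_mono)
  qed
  consider "u = 0" | "v = 0" | "0 < u" "0 < v"
    using assms by linarith
  then show ?thesis
  proof cases
    case 1
    then show ?thesis
      using shrink[of "1 - l" v] assms by simp
  next
    case 2
    then show ?thesis
      using shrink[of l u] assms by simp
  next
    case 3
    then show ?thesis
      using convex_onD[OF powr_convex[OF assms(1)], of "1 - l" u v] assms by simp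
  qed
qed

lemma lpnorm_nonneg [simp]: "0 \<le> lpnorm p x"
  by (simp add: lpnorm_def)

lemma lpnorm_zero [simp]: "lpnorm p (\<lambda>n. 0) = 0"
  by (simp add: lpnorm_def)

lemma lp_zero [simp]: "(\<lambda>n. 0) \<in> lp p"
  by (simp add: lp_def)

lemma nat_powr_unbounded:
  fixes a B :: real
  assumes "0 < a"
  shows "\<exists>m::nat. 0 < m \<and> B < real m powr a"
proof -
  obtain m :: nat where m: "(\<bar>B\<bar> + 1) powr (1 / a) < real m"
    using reals_Archimedean2 by blast
  have "0 < m"
    using m by (cases m) (auto simp: not_less)
  moreover have "\<bar>B\<bar> + 1 < real m powr a"
    using powr_less_mono2[OF assms _ m] assms by (simp add: powr_powr)
  ultimately show ?thesis
    by (intro exI[of _ m]) linarith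
qed

lemma seq_diff_conv: "seq_diff x y = seq_add x (seq_scale (-1) y)"
  by (simp add: seq_diff_def seq_add_def seq_scale_def)

lemma bounded_opD:
  assumes "bounded_op p T"
  shows "x \<in> lp p \<Longrightarrow> T x \<in> lp p"
    and "x \<in> lp p \<Longrightarrow> y \<in> lp p \<Longrightarrow> T (seq_add x y) = seq_add (T x) (T y)"
    and "x \<in> lp p \<Longrightarrow> T (seq_scale c x) = seq_scale c (T x)"
  using assms by (auto simp: bounded_op_def)

lemma compact_op_bounded: "compact_op p K \<Longrightarrow> bounded_op p K"
  by (simp add: compact_op_def)

lemma compact_opE:
  fixes x :: "nat \<Rightarrow> seq"
  assumes "compact_op p K" "\<And>n. x n \<in> lp p" "\<And>n. lpnorm p (x n) \<le> 1"
  obtains r y where "strict_mono r" "y \<in> lp p"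
    "(\<lambda>n. lpnorm p (seq_diff (K (x (r n))) y)) \<longlonglongrightarrow> 0"
  using assms unfolding compact_op_def by blast

text \<open>\<open>V\<close> carries the second action to the first one modulo compact operators. It
  is asked to be bounded below rather than invertible, so that an invertible operator composed with
  the embedding of a summand qualifies.\<close>

definition intertwiner :: "real \<Rightarrow> ((real \<Rightarrow> complex) \<Rightarrow> bop) \<Rightarrow> ((real \<Rightarrow> complex) \<Rightarrow> bop) \<Rightarrow> bop \<Rightarrow> bool" where
  "intertwiner p \<rho>1 \<rho>2 V \<longleftrightarrow> bounded_op p V \<and>
     (\<exists>c>0. \<forall>x\<in>lp p. c * lpnorm p x \<le> lpnorm p (V x)) \<and>
     (\<forall>f\<in>C01. compact_op p (\<lambda>x. seq_diff (V (\<rho>2 f x)) (\<rho>1 f (V x))))"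

context
  fixes p :: real
  assumes p_gt_1: "1 < p"
begin

lemma lpnorm_powr: "x \<in> lp p \<Longrightarrow> lpnorm p x powr p = (\<Sum>n. cmod (x n) powr p)"
  using p_gt_1 by (simp add: lpnorm_def lp_def powr_powr suminf_nonneg)

lemma lpnorm_le_iff:
  assumes "x \<in> lp p" "0 \<le> A"
  shows "lpnorm p x \<le> A \<longleftrightarrow> (\<Sum>n. cmod (x n) powr p) \<le> A powr p"
  unfolding lpnorm_powr[OF assms(1), symmetric]
  using assms p_gt_1 powr_less_mono2[of p A "lpnorm p x"] powr_mono2[of p "lpnorm p x" A] by force

lemma lpnorm_le_of_sums:
  assumes "\<And>N. (\<Sum>n<N. cmod (x n) powr p) \<le> A powr p" "0 \<le> A"
  shows "x \<in> lp p" "lpnorm p x \<le> A"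
proof -
  have s: "summable (\<lambda>n. cmod (x n) powr p)"
    using assms(1) by (intro summableI_nonneg_bounded) auto
  then show "x \<in> lp p"
    by (simp add: lp_def)
  then show "lpnorm p x \<le> A"
    using s suminf_le_const[OF s assms(1)] lpnorm_le_iff assms(2) by simp
qed

lemma coordinate_le_lpnorm:
  assumes "x \<in> lp p"
  shows "cmod (x n) \<le> lpnorm p x"
proof -
  have "cmod (x n) powr p \<le> lpnorm p x powr p"
    using assms sum_le_suminf[of "\<lambda>n. cmod (x n) powr p" "{n}"]
    by (simp add: lpnorm_powr lp_def)
  then show ?thesis
    using p_gt_1 powr_less_mono2[of p "lpnorm p x" "cmod (x n)"] by force
qed

text \<open>Minkowski's inequality from convexity: (|x| + |y|) / (A + B) is the convex combination
  of |x| / A and |y| / B with weight A / (A + B) on the former. Positive upper bounds A and B in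
  place of the norms avoid division by zero.\<close>

lemma lpnorm_add_le_aux:
  assumes "x \<in> lp p" "y \<in> lp p" "lpnorm p x \<le> A" "lpnorm p y \<le> B" "0 < A" "0 < B"
  shows "seq_add x y \<in> lp p" "lpnorm p (seq_add x y) \<le> A + B"
proof -
  define l where "l = A / (A + B)"
  have l: "0 \<le> l" "l \<le> 1" "1 - l = B / (A + B)"
    using assms by (auto simp: l_def field_simps)
  have pointwise: "cmod (x n + y n) powr p \<le>
      (A + B) powr p * (l * (cmod (x n) powr p / A powr p) + (1 - l) * (cmod (y n) powr p / B powr p))" for n
  proof -
    have "cmod (x n + y n) \<le> cmod (x n) + cmod (y n)"
      by (rule norm_triangle_ineq)
    also have "\<dots> = (A + B) * (l * (cmod (x n) / A) + (1 - l) * (cmod (y n) / B))"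
    proof -
      have "(A + B) * l = A" "(A + B) * (1 - l) = B"
        unfolding l(3) using assms by (auto simp: l_def)
      then show ?thesis
        using assms by (simp add: distrib_left flip: mult.assoc)
    qed
    finally have "cmod (x n + y n) powr p \<le>
        ((A + B) * (l * (cmod (x n) / A) + (1 - l) * (cmod (y n) / B))) powr p"
      using p_gt_1 by (intro powr_mono2) auto
    also have "\<dots> = (A + B) powr p * (l * (cmod (x n) / A) + (1 - l) * (cmod (y n) / B)) powr p"
      using assms l by (subst powr_mult) auto
    also have "\<dots> \<le> (A + B) powr p *
        (l * (cmod (x n) / A) powr p + (1 - l) * (cmod (y n) / B) powr p)"
      using powr_convex_comb[of p "cmod (x n) / A" "cmod (y n) / B" l] assms l p_gt_1
      by (intro mult_left_mono) auto
    finally show ?thesis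
      using assms by (simp add: powr_divide)
  qed
  have partial: "(\<Sum>n<N. cmod (z n) powr p) \<le> C powr p" if "z \<in> lp p" "lpnorm p z \<le> C" "0 < C" for N z C
    using sum_le_suminf[of "\<lambda>n. cmod (z n) powr p" "{..<N}"] that lpnorm_le_iff[of z C]
    by (auto simp: lp_def)
  have "(\<Sum>n<N. cmod (seq_add x y n) powr p) \<le> (A + B) powr p" for N
  proof -
    have "(\<Sum>n<N. cmod (seq_add x y n) powr p) \<le> (\<Sum>n<N. (A + B) powr p *
        (l * (cmod (x n) powr p / A powr p) + (1 - l) * (cmod (y n) powr p / B powr p)))"
      unfolding seq_add_def by (intro sum_mono pointwise)
    also have "\<dots> = (A + B) powr p * (l * ((\<Sum>n<N. cmod (x n) powr p) / A powr p)
        + (1 - l) * ((\<Sum>n<N. cmod (y n) powr p) / B powr p))"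
      by (simp add: sum.distrib flip: sum_distrib_left sum_divide_distrib)
    also have "\<dots> \<le> (A + B) powr p * (l * 1 + (1 - l) * 1)"
      using partial[of x A N] partial[of y B N] assms l
      by (intro mult_left_mono add_mono) (auto simp: field_simps)
    finally show ?thesis
      by simp
  qed
  then show "seq_add x y \<in> lp p" "lpnorm p (seq_add x y) \<le> A + B"
    using assms lpnorm_le_of_sums[of "seq_add x y" "A + B"] by auto
qed

lemma lp_add:
  assumes "x \<in> lp p" "y \<in> lp p"
  shows "seq_add x y \<in> lp p"
  using lpnorm_add_le_aux(1)[OF assms, of "lpnorm p x + 1" "lpnorm p y + 1"]
  by (simp add: add_nonneg_pos)

lemma lpnorm_add_le:
  assumes "x \<in> lp p" "y \<in> lp p"
  shows "lpnorm p (seq_add x y) \<le> lpnorm p x + lpnorm p y"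
proof (rule field_le_epsilon)
  fix e :: real
  assume "0 < e"
  then show "lpnorm p (seq_add x y) \<le> lpnorm p x + lpnorm p y + e"
    using lpnorm_add_le_aux(2)[OF assms, of "lpnorm p x + e / 2" "lpnorm p y + e / 2"]
    by (simp add: add_nonneg_pos)
qed

lemma lp_scale: "x \<in> lp p \<Longrightarrow> seq_scale c x \<in> lp p"
  by (simp add: lp_def seq_scale_def norm_mult powr_mult summable_mult)

lemma lpnorm_scale: "x \<in> lp p \<Longrightarrow> lpnorm p (seq_scale c x) = cmod c * lpnorm p x"
  using p_gt_1
  by (simp add: lp_def lpnorm_def seq_scale_def norm_mult powr_mult suminf_mult suminf_nonneg
      powr_powr)

lemma lp_diff: "x \<in> lp p \<Longrightarrow> y \<in> lp p \<Longrightarrow> seq_diff x y \<in> lp p"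
  by (simp add: seq_diff_conv lp_add lp_scale)

lemma lpnorm_le_diff_add:
  assumes "x \<in> lp p" "y \<in> lp p"
  shows "lpnorm p x \<le> lpnorm p (seq_diff x y) + lpnorm p y"
proof -
  have "x = seq_add (seq_diff x y) y"
    by (simp add: seq_add_def seq_diff_def)
  then show ?thesis
    using lpnorm_add_le[OF lp_diff[OF assms] assms(2)] by simp
qed

lemma lpnorm_diff_commute:
  assumes "x \<in> lp p" "y \<in> lp p"
  shows "lpnorm p (seq_diff x y) = lpnorm p (seq_diff y x)"
proof -
  have "seq_diff x y = seq_scale (-1) (seq_diff y x)"
    by (simp add: seq_scale_def seq_diff_def)
  then show ?thesis
    using assms by (simp add: lpnorm_scale lp_diff)
qed

lemma lp_sum:
  assumes "finite F" "\<And>i. i \<in> F \<Longrightarrow> x i \<in> lp p"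
  shows "(\<lambda>k. \<Sum>i\<in>F. x i k) \<in> lp p"
  using assms
proof (induction F rule: finite_induct)
  case (insert i F)
  then show ?case
    using lp_add[of "x i" "\<lambda>k. \<Sum>i\<in>F. x i k"] by (simp add: seq_add_def)
qed simp

lemma lpnorm_sum_le:
  assumes "finite F" "\<And>i. i \<in> F \<Longrightarrow> x i \<in> lp p"
  shows "lpnorm p (\<lambda>k. \<Sum>i\<in>F. x i k) \<le> (\<Sum>i\<in>F. lpnorm p (x i))"
  using assms
proof (induction F rule: finite_induct)
  case (insert i F)
  then show ?case
    using lpnorm_add_le[of "x i" "\<lambda>k. \<Sum>i\<in>F. x i k"] lp_sum[of F x] by (simp add: seq_add_def)
qed simp

lemma lpnorm_sum_disjoint:
  assumes "finite F" "\<And>i. i \<in> F \<Longrightarrow> x i \<in> lp p"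
    and "\<And>i j k. i \<in> F \<Longrightarrow> j \<in> F \<Longrightarrow> i \<noteq> j \<Longrightarrow> x i k = 0 \<or> x j k = 0"
  shows "lpnorm p (\<lambda>k. \<Sum>i\<in>F. x i k) powr p = (\<Sum>i\<in>F. lpnorm p (x i) powr p)"
proof -
  have "cmod (\<Sum>i\<in>F. x i k) powr p = (\<Sum>i\<in>F. cmod (x i k) powr p)" for k
  proof (cases "\<exists>i\<in>F. x i k \<noteq> 0")
    case True
    then obtain i where i: "i \<in> F" "x i k \<noteq> 0"
      by blast
    then have "x j k = 0" if "j \<in> F - {i}" for j
      using assms(3)[of i j k] that by blast
    then show ?thesis
      using assms(1) i by (simp add: sum.remove)
  qed simp
  then have "lpnorm p (\<lambda>k. \<Sum>i\<in>F. x i k) powr p = (\<Sum>k. \<Sum>i\<in>F. cmod (x i k) powr p)"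
    using lp_sum[of F x] assms(1,2) by (simp add: lpnorm_powr)
  also have "\<dots> = (\<Sum>i\<in>F. \<Sum>k. cmod (x i k) powr p)"
    using assms(2) by (intro suminf_sum) (simp add: lp_def)
  finally show ?thesis
    using assms(2) by (simp add: lpnorm_powr)
qed

section \<open>Bounded operators\<close>

lemma bounded_op_bound:
  assumes "bounded_op p T"
  obtains M where "0 < M" "\<And>x. x \<in> lp p \<Longrightarrow> lpnorm p (T x) \<le> M * lpnorm p x"
proof -
  obtain M where M: "\<And>x. x \<in> lp p \<Longrightarrow> lpnorm p (T x) \<le> M * lpnorm p x"
    using assms unfolding bounded_op_def by blast
  have "lpnorm p (T x) \<le> (\<bar>M\<bar> + 1) * lpnorm p x" if "x \<in> lp p" for x
    by (intro order_trans[OF M[OF that] mult_right_mono]) auto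
  then show ?thesis
    using that[of "\<bar>M\<bar> + 1"] by simp
qed

lemma bounded_op_diff_arg:
  assumes "bounded_op p T" "x \<in> lp p" "y \<in> lp p"
  shows "T (seq_diff x y) = seq_diff (T x) (T y)"
  using assms by (simp add: seq_diff_conv bounded_opD lp_scale)

lemma bounded_op_zero_arg:
  assumes "bounded_op p T"
  shows "T (\<lambda>n. 0) = (\<lambda>n. 0)"
  using bounded_opD(3)[OF assms lp_zero, of 0] by (simp add: seq_scale_def)

lemma bounded_op_sum_arg:
  assumes "bounded_op p T" "finite F" "\<And>i. i \<in> F \<Longrightarrow> x i \<in> lp p"
  shows "T (\<lambda>k. \<Sum>i\<in>F. x i k) = (\<lambda>k. \<Sum>i\<in>F. T (x i) k)"
  using assms(2,3)
proof (induction F rule: finite_induct)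
  case empty
  then show ?case
    using bounded_op_zero_arg[OF assms(1)] by simp
next
  case (insert i F)
  then show ?case
    using bounded_opD(2)[OF assms(1), of "x i" "\<lambda>k. \<Sum>i\<in>F. x i k"] lp_sum[of F x]
    by (simp add: seq_add_def)
qed

lemma bounded_op_cong:
  assumes "bounded_op p T" "\<And>x. x \<in> lp p \<Longrightarrow> T x = T' x"
  shows "bounded_op p T'"
proof -
  obtain M where "\<And>x. x \<in> lp p \<Longrightarrow> lpnorm p (T x) \<le> M * lpnorm p x"
    using assms(1) by (rule bounded_op_bound) blast
  then show ?thesis
    using assms by (auto simp: bounded_op_def lp_add lp_scale intro!: exI[of _ M])
qed

lemma bounded_op_id: "bounded_op p (\<lambda>x. x)"
  by (auto simp: bounded_op_def intro!: exI[of _ 1])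

lemma bounded_op_zero: "bounded_op p (\<lambda>x n. 0)"
  by (auto simp: bounded_op_def seq_add_def seq_scale_def intro!: exI[of _ 0])

lemma bounded_op_comp:
  assumes "bounded_op p T" "bounded_op p U"
  shows "bounded_op p (\<lambda>x. T (U x))"
proof -
  obtain M where M: "0 < M" "\<And>x. x \<in> lp p \<Longrightarrow> lpnorm p (T x) \<le> M * lpnorm p x"
    using assms(1) by (rule bounded_op_bound) blast
  obtain N where N: "0 < N" "\<And>x. x \<in> lp p \<Longrightarrow> lpnorm p (U x) \<le> N * lpnorm p x"
    using assms(2) by (rule bounded_op_bound) blast
  have "lpnorm p (T (U x)) \<le> (M * N) * lpnorm p x" if "x \<in> lp p" for x
    unfolding mult.assoc
    using order_trans[OF M(2)[OF bounded_opD(1)[OF assms(2) that]] mult_left_mono[OF N(2)[OF that]]] M(1)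
    by simp
  then show ?thesis
    using assms unfolding bounded_op_def[of p "\<lambda>x. T (U x)"] by (auto simp: bounded_opD)
qed

lemma bounded_op_add:
  assumes "bounded_op p T" "bounded_op p U"
  shows "bounded_op p (\<lambda>x. seq_add (T x) (U x))"
proof -
  obtain M where M: "0 < M" "\<And>x. x \<in> lp p \<Longrightarrow> lpnorm p (T x) \<le> M * lpnorm p x"
    using assms(1) by (rule bounded_op_bound) blast
  obtain N where N: "0 < N" "\<And>x. x \<in> lp p \<Longrightarrow> lpnorm p (U x) \<le> N * lpnorm p x"
    using assms(2) by (rule bounded_op_bound) blast
  have "lpnorm p (seq_add (T x) (U x)) \<le> (M + N) * lpnorm p x" if "x \<in> lp p" for x
    using M(2)[of x] N(2)[of x] lpnorm_add_le[of "T x" "U x"] that assms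
    by (simp add: bounded_opD distrib_right)
  then show ?thesis
    using assms unfolding bounded_op_def[of p "\<lambda>x. seq_add (T x) (U x)"]
    by (auto simp: bounded_opD lp_add) (auto simp: seq_add_def seq_scale_def algebra_simps)
qed

lemma bounded_op_scale:
  assumes "bounded_op p T"
  shows "bounded_op p (\<lambda>x. seq_scale c (T x))"
proof -
  obtain M where M: "0 < M" "\<And>x. x \<in> lp p \<Longrightarrow> lpnorm p (T x) \<le> M * lpnorm p x"
    using assms(1) by (rule bounded_op_bound) blast
  have "lpnorm p (seq_scale c (T x)) \<le> (cmod c * M) * lpnorm p x" if "x \<in> lp p" for x
    using M(2)[of x] that assms by (simp add: bounded_opD lpnorm_scale mult.assoc mult_left_mono)
  then show ?thesis
    using assms unfolding bounded_op_def[of p "\<lambda>x. seq_scale c (T x)"]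
    by (auto simp: bounded_opD lp_scale) (auto simp: seq_add_def seq_scale_def algebra_simps)
qed

section \<open>The operator norm\<close>

lemma lpnorm_le_opnorm:
  assumes "bounded_op p T" "x \<in> lp p" "lpnorm p x \<le> 1"
  shows "lpnorm p (T x) \<le> opnorm p T"
proof -
  obtain M where M: "0 < M" "\<And>x. x \<in> lp p \<Longrightarrow> lpnorm p (T x) \<le> M * lpnorm p x"
    using assms(1) by (rule bounded_op_bound) blast
  have "bdd_above {lpnorm p (T x) |x. x \<in> lp p \<and> lpnorm p x \<le> 1}"
  proof (rule bdd_aboveI[of _ M], clarify)
    fix x
    assume "x \<in> lp p" "lpnorm p x \<le> 1"
    then show "lpnorm p (T x) \<le> M"
      using order_trans[OF M(2) mult_left_le, of x] M(1) by simp
  qed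
  then show ?thesis
    unfolding opnorm_def using assms by (intro cSup_upper) auto
qed

lemma opnorm_le:
  assumes "\<And>x. x \<in> lp p \<Longrightarrow> lpnorm p (T x) \<le> M * lpnorm p x" "0 \<le> M"
  shows "opnorm p T \<le> M"
  unfolding opnorm_def
proof (rule cSup_least)
  show "{lpnorm p (T x) |x. x \<in> lp p \<and> lpnorm p x \<le> 1} \<noteq> {}"
    using lp_zero by (auto intro!: exI[of _ "\<lambda>n. 0"])
next
  fix r
  assume "r \<in> {lpnorm p (T x) |x. x \<in> lp p \<and> lpnorm p x \<le> 1}"
  then obtain x where "r = lpnorm p (T x)" "x \<in> lp p" "lpnorm p x \<le> 1"
    by blast
  then show "r \<le> M"
    using order_trans[OF assms(1) mult_left_le, of x] assms(2) by simp
qed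

section \<open>Compact operators and the Calkin algebra\<close>

lemma compact_op_cong:
  assumes "compact_op p K" "\<And>x. x \<in> lp p \<Longrightarrow> K x = K' x"
  shows "compact_op p K'"
proof -
  have "bounded_op p K'"
    using assms bounded_op_cong compact_op_bounded by blast
  moreover have "\<exists>r y. strict_mono r \<and> y \<in> lp p \<and>
      (\<lambda>n. lpnorm p (seq_diff (K' (x (r n))) y)) \<longlonglongrightarrow> 0"
    if x: "\<forall>n. x n \<in> lp p \<and> lpnorm p (x n) \<le> 1" for x :: "nat \<Rightarrow> seq"
  proof -
    obtain r y where "strict_mono r" "y \<in> lp p"
      "(\<lambda>n. lpnorm p (seq_diff (K (x (r n))) y)) \<longlonglongrightarrow> 0"
      using x assms(1) by (auto elim!: compact_opE[of p K x])
    then show ?thesis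
      using x assms(2) by auto
  qed
  ultimately show ?thesis
    unfolding compact_op_def by blast
qed

lemma compact_op_zero: "compact_op p (\<lambda>x n. 0)"
  unfolding compact_op_def
proof (intro conjI allI impI)
  show "\<exists>(r :: nat \<Rightarrow> nat) y. strict_mono r \<and> y \<in> lp p \<and> (\<lambda>n. lpnorm p (seq_diff (\<lambda>n. 0) y)) \<longlonglongrightarrow> 0"
    by (rule exI[of _ id], rule exI[of _ "\<lambda>n. 0"]) (simp add: seq_diff_def strict_mono_def)
qed (rule bounded_op_zero)

lemma lpnorm_tendsto_zero_bound:
  assumes "f \<longlonglongrightarrow> 0" "\<And>n. lpnorm p (g n) \<le> f n"
  shows "(\<lambda>n. lpnorm p (g n)) \<longlonglongrightarrow> 0"
  by (rule tendsto_sandwich[OF _ _ tendsto_const assms(1)]) (auto simp: assms(2))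

lemma compact_op_comp_left:
  assumes "compact_op p K" "bounded_op p T"
  shows "compact_op p (\<lambda>x. T (K x))"
  unfolding compact_op_def
proof (intro conjI allI impI)
  show "bounded_op p (\<lambda>x. T (K x))"
    by (rule bounded_op_comp[OF assms(2) compact_op_bounded[OF assms(1)]])
next
  fix x :: "nat \<Rightarrow> seq"
  assume x: "\<forall>n. x n \<in> lp p \<and> lpnorm p (x n) \<le> 1"
  obtain M where M: "0 < M" "\<And>x. x \<in> lp p \<Longrightarrow> lpnorm p (T x) \<le> M * lpnorm p x"
    using assms(2) by (rule bounded_op_bound) blast
  obtain r y where r: "strict_mono r" "y \<in> lp p"
    "(\<lambda>n. lpnorm p (seq_diff (K (x (r n))) y)) \<longlonglongrightarrow> 0"
    using x assms(1) by (auto elim!: compact_opE[of p K x])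
  have K: "K (x n) \<in> lp p" for n
    using x compact_op_bounded[OF assms(1)] by (simp add: bounded_opD)
  have "(\<lambda>n. lpnorm p (seq_diff (T (K (x (r n)))) (T y))) \<longlonglongrightarrow> 0"
  proof (rule lpnorm_tendsto_zero_bound)
    show "(\<lambda>n. M * lpnorm p (seq_diff (K (x (r n))) y)) \<longlonglongrightarrow> 0"
      using tendsto_mult_left[OF r(3), of M] by simp
    show "lpnorm p (seq_diff (T (K (x (r n)))) (T y)) \<le> M * lpnorm p (seq_diff (K (x (r n))) y)" for n
      using M(2)[OF lp_diff[OF K r(2)]] bounded_op_diff_arg[OF assms(2) K r(2)] by simp
  qed
  then show "\<exists>r y. strict_mono r \<and> y \<in> lp p \<and>
      (\<lambda>n. lpnorm p (seq_diff (T (K (x (r n)))) y)) \<longlonglongrightarrow> 0"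
    using r bounded_opD(1)[OF assms(2)] by blast
qed

lemma compact_op_scale: "compact_op p K \<Longrightarrow> compact_op p (\<lambda>x. seq_scale c (K x))"
  using compact_op_comp_left[OF _ bounded_op_scale[OF bounded_op_id]] by simp

text \<open>Compactness is tested on the unit ball, so \<open>T\<close> is first divided by a bound
  M to become a contraction; linearity restores the factor at the end.\<close>

lemma compact_op_comp_right:
  assumes "compact_op p K" "bounded_op p T"
  shows "compact_op p (\<lambda>x. K (T x))"
proof -
  obtain M where M: "0 < M" "\<And>x. x \<in> lp p \<Longrightarrow> lpnorm p (T x) \<le> M * lpnorm p x"
    using assms(2) by (rule bounded_op_bound) blast
  define c where "c = complex_of_real (1 / M)"
  have contraction: "seq_scale c (T x) \<in> lp p \<and> lpnorm p (seq_scale c (T x)) \<le> 1"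
    if "x \<in> lp p" "lpnorm p x \<le> 1" for x
  proof -
    have "lpnorm p (T x) \<le> M"
      using order_trans[OF M(2)[OF that(1)] mult_left_le] that(2) M(1) by simp
    then show ?thesis
      using M(1) assms(2) that by (simp add: c_def lp_scale lpnorm_scale bounded_opD norm_divide)
  qed
  have "compact_op p (\<lambda>x. K (seq_scale c (T x)))"
    unfolding compact_op_def
  proof (intro conjI allI impI)
    show "bounded_op p (\<lambda>x. K (seq_scale c (T x)))"
      using bounded_op_comp[OF compact_op_bounded[OF assms(1)] bounded_op_scale[OF assms(2)]] .
  next
    fix x :: "nat \<Rightarrow> seq"
    assume "\<forall>n. x n \<in> lp p \<and> lpnorm p (x n) \<le> 1"
    then have "\<forall>n. seq_scale c (T (x n)) \<in> lp p \<and> lpnorm p (seq_scale c (T (x n))) \<le> 1"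
      using contraction by blast
    then show "\<exists>r y. strict_mono r \<and> y \<in> lp p \<and>
        (\<lambda>n. lpnorm p (seq_diff (K (seq_scale c (T (x (r n))))) y)) \<longlonglongrightarrow> 0"
      using assms(1) by (auto elim!: compact_opE[of p K "\<lambda>n. seq_scale c (T (x n))"])
  qed
  then have "compact_op p (\<lambda>x. seq_scale M (K (seq_scale c (T x))))"
    by (rule compact_op_scale)
  then show ?thesis
  proof (rule compact_op_cong)
    fix x
    assume "x \<in> lp p"
    then have "T x \<in> lp p"
      by (rule bounded_opD(1)[OF assms(2)])
    then show "seq_scale M (K (seq_scale c (T x))) = K (T x)"
      using bounded_opD(3)[OF compact_op_bounded[OF assms(1)], of "T x" c] M(1)
      by (simp add: seq_scale_def c_def)
  qed
qed

lemma compact_op_add: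
  assumes "compact_op p K" "compact_op p L"
  shows "compact_op p (\<lambda>x. seq_add (K x) (L x))"
  unfolding compact_op_def
proof (intro conjI allI impI)
  show "bounded_op p (\<lambda>x. seq_add (K x) (L x))"
    using assms by (intro bounded_op_add compact_op_bounded)
next
  fix x :: "nat \<Rightarrow> seq"
  assume x: "\<forall>n. x n \<in> lp p \<and> lpnorm p (x n) \<le> 1"
  obtain r y where r: "strict_mono r" "y \<in> lp p"
    "(\<lambda>n. lpnorm p (seq_diff (K (x (r n))) y)) \<longlonglongrightarrow> 0"
    using x assms(1) by (auto elim!: compact_opE[of p K x])
  obtain s z where s: "strict_mono s" "z \<in> lp p"
    "(\<lambda>n. lpnorm p (seq_diff (L (x (r (s n)))) z)) \<longlonglongrightarrow> 0"
    using x assms(2) by (auto elim!: compact_opE[of p L "\<lambda>n. x (r n)"])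
  have K: "K (x n) \<in> lp p" and L: "L (x n) \<in> lp p" for n
    using x assms by (auto simp: bounded_opD compact_op_bounded)
  have "(\<lambda>n. lpnorm p (seq_diff (seq_add (K (x ((r \<circ> s) n))) (L (x ((r \<circ> s) n)))) (seq_add y z))) \<longlonglongrightarrow> 0"
  proof (rule lpnorm_tendsto_zero_bound)
    show "(\<lambda>n. lpnorm p (seq_diff (K (x (r (s n)))) y) + lpnorm p (seq_diff (L (x (r (s n)))) z)) \<longlonglongrightarrow> 0"
      using tendsto_add[OF LIMSEQ_subseq_LIMSEQ[OF r(3) s(1)] s(3)] by (simp add: o_def)
    fix n
    have "seq_diff (seq_add (K (x ((r \<circ> s) n))) (L (x ((r \<circ> s) n)))) (seq_add y z) =
        seq_add (seq_diff (K (x (r (s n)))) y) (seq_diff (L (x (r (s n)))) z)"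
      by (auto simp: seq_diff_def seq_add_def)
    then show "lpnorm p (seq_diff (seq_add (K (x ((r \<circ> s) n))) (L (x ((r \<circ> s) n)))) (seq_add y z)) \<le>
        lpnorm p (seq_diff (K (x (r (s n)))) y) + lpnorm p (seq_diff (L (x (r (s n)))) z)"
      using lpnorm_add_le[OF lp_diff[OF K r(2)] lp_diff[OF L s(2)]] by simp
  qed
  then show "\<exists>r y. strict_mono r \<and> y \<in> lp p \<and>
      (\<lambda>n. lpnorm p (seq_diff (seq_add (K (x (r n))) (L (x (r n)))) y)) \<longlonglongrightarrow> 0"
    using strict_mono_o[OF r(1) s(1)] lp_add[OF r(2) s(2)] by blast
qed

lemma compact_op_diff_commute:
  assumes "compact_op p (\<lambda>x. seq_diff (S x) (T x))"
  shows "compact_op p (\<lambda>x. seq_diff (T x) (S x))"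
  by (rule compact_op_cong[OF compact_op_scale[OF assms, of "-1"]])
    (auto simp: seq_scale_def seq_diff_def)

lemma compact_op_diff_trans:
  assumes "compact_op p (\<lambda>x. seq_diff (S x) (T x))" "compact_op p (\<lambda>x. seq_diff (T x) (U x))"
  shows "compact_op p (\<lambda>x. seq_diff (S x) (U x))"
  by (rule compact_op_cong[OF compact_op_add[OF assms]]) (auto simp: seq_add_def seq_diff_def)

section \<open>Classes modulo compact operators\<close>

lemma calkin_pi_self: "bounded_op p T \<Longrightarrow> T \<in> calkin_pi p T"
  using compact_op_zero by (simp add: calkin_pi_def seq_diff_def)

lemma calkin_pi_eqI:
  assumes "compact_op p (\<lambda>x. seq_diff (S x) (T x))"
  shows "calkin_pi p S = calkin_pi p T"
  using compact_op_diff_trans[OF _ assms] compact_op_diff_trans[OF _ compact_op_diff_commute[OF assms]]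
  by (auto simp: calkin_pi_def)

lemma calkin_pi_eqD:
  assumes "calkin_pi p S = calkin_pi p T" "bounded_op p S"
  shows "compact_op p (\<lambda>x. seq_diff (S x) (T x))"
  using calkin_pi_self[OF assms(2)] unfolding assms(1) by (simp add: calkin_pi_def)

text \<open>The representative picked by \<open>rep\<close> is unspecified; every later use of it
  goes through these two facts.\<close>

lemma rep_calkin_pi:
  assumes "bounded_op p T"
  shows "bounded_op p (rep (calkin_pi p T))"
    "compact_op p (\<lambda>x. seq_diff (rep (calkin_pi p T) x) (T x))"
  using someI[of "\<lambda>S. S \<in> calkin_pi p T", OF calkin_pi_self[OF assms]]
  by (auto simp: rep_def calkin_pi_def)

text \<open>Disjointly supported normalised vectors are weakly null because \<open>p > 1\<close>: a sum of \<open>m\<close> of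
  them has norm \<open>m powr (1 / p)\<close>, whereas a functional staying away from zero on them grows
  like \<open>m\<close>.\<close>

lemma compact_op_disjoint_sequence:
  fixes x :: "nat \<Rightarrow> seq"
  assumes K: "compact_op p K" and x: "\<And>n. x n \<in> lp p" "\<And>n. lpnorm p (x n) = 1"
    and disj: "\<And>m n k. m \<noteq> n \<Longrightarrow> x m k = 0 \<or> x n k = 0"
    and "0 < e"
  shows "finite {n. e \<le> lpnorm p (K (x n))}"
proof (rule ccontr)
  assume "infinite {n. e \<le> lpnorm p (K (x n))}"
  then obtain s :: "nat \<Rightarrow> nat" where s: "strict_mono s" "\<And>n. e \<le> lpnorm p (K (x (s n)))"
    using infinite_enumerate by blast
  note bK = compact_op_bounded[OF K]
  obtain r y where r: "strict_mono r" "y \<in> lp p"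
    "(\<lambda>n. lpnorm p (seq_diff (K (x (s (r n)))) y)) \<longlonglongrightarrow> 0"
    using compact_opE[OF K, of "\<lambda>n. x (s n)"] x by auto
  define u where "u n = x (s (r n))" for n
  have u: "u n \<in> lp p" "lpnorm p (u n) = 1" "K (u n) \<in> lp p" for n
    using x bounded_opD(1)[OF bK] by (auto simp: u_def)
  have u_disj: "u m k = 0 \<or> u n k = 0" if "m \<noteq> n" for m n k
    using disj[of "s (r m)" "s (r n)" k] that s(1) r(1)
    by (auto simp: u_def strict_mono_eq)
  have lim: "(\<lambda>n. lpnorm p (seq_diff (K (u n)) y)) \<longlonglongrightarrow> 0"
    using r(3) by (simp add: u_def)
  have "e \<le> 0 + lpnorm p y"
  proof (rule LIMSEQ_le_const[OF tendsto_add[OF lim tendsto_const]])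
    show "\<exists>N. \<forall>n\<ge>N. e \<le> lpnorm p (seq_diff (K (u n)) y) + lpnorm p y"
      using order_trans[OF s(2) lpnorm_le_diff_add[OF u(3)[unfolded u_def] r(2)]]
      by (auto simp: u_def)
  qed
  then have "y \<noteq> (\<lambda>n. 0)"
    using \<open>0 < e\<close> by auto
  then obtain k where k: "y k \<noteq> 0"
    by auto
  \<comment> \<open>Late images have k-th coordinate within d of \<open>y k\<close>, and the modulus
    of \<open>y k\<close> is 2d. Hence in the sum of m of them that coordinate has modulus at least
    m d.\<close>
  define d where "d = cmod (y k) / 2"
  have d: "0 < d"
    using k by (simp add: d_def)
  obtain n0 where n0: "\<And>n. n0 \<le> n \<Longrightarrow> lpnorm p (seq_diff (K (u n)) y) < d"
    using order_tendstoD(2)[OF lim d] by (auto simp: eventually_sequentially)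
  obtain M where M: "0 < M" "\<And>x. x \<in> lp p \<Longrightarrow> lpnorm p (K x) \<le> M * lpnorm p x"
    using bounded_op_bound[OF bK] by blast
  have growth: "real m * d \<le> M * real m powr (1 / p)" for m
  proof -
    define z where "z = (\<lambda>k. \<Sum>i<m. u (n0 + i) k)"
    have z: "z \<in> lp p"
      unfolding z_def by (rule lp_sum) (auto simp: u)
    have "lpnorm p z powr p = (\<Sum>i<m. lpnorm p (u (n0 + i)) powr p)"
      unfolding z_def by (rule lpnorm_sum_disjoint) (auto simp: u u_disj)
    then have "lpnorm p z powr p = real m"
      by (simp add: u)
    then have norm_z: "lpnorm p z = real m powr (1 / p)"
      using p_gt_1 by (metis lpnorm_nonneg powr_powr powr_one times_divide_eq_right mult.right_neutral
          divide_self_if less_irrefl not_one_less_zero)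
    have Kz: "K z = (\<lambda>k. \<Sum>i<m. K (u (n0 + i)) k)"
      unfolding z_def by (rule bounded_op_sum_arg[OF bK]) (auto simp: u)
    have "cmod (K z k - real m * y k) \<le> (\<Sum>i<m. cmod (K (u (n0 + i)) k - y k))"
      using norm_sum[of "\<lambda>i. K (u (n0 + i)) k - y k" "{..<m}"] by (simp add: Kz sum_subtractf)
    also have "\<dots> \<le> (\<Sum>i<m. d)"
    proof (rule sum_mono)
      fix i
      have "cmod (seq_diff (K (u (n0 + i))) y k) \<le> lpnorm p (seq_diff (K (u (n0 + i))) y)"
        by (intro coordinate_le_lpnorm lp_diff u r)
      then show "cmod (K (u (n0 + i)) k - y k) \<le> d"
        using n0[of "n0 + i"] by (simp add: seq_diff_def)
    qed
    finally have "cmod (K z k - real m * y k) \<le> real m * d"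
      by simp
    moreover have "cmod (of_nat m * y k) = 2 * (real m * d)"
      by (simp add: d_def norm_mult)
    moreover have "cmod (K z k) \<le> M * lpnorm p z"
      using coordinate_le_lpnorm[OF bounded_opD(1)[OF bK z], of k] M(2)[OF z] by linarith
    ultimately show ?thesis
      using norm_triangle_ineq2[of "of_nat m * y k" "K z k"] norm_minus_commute[of "of_nat m * y k" "K z k"]
      unfolding norm_z by simp
  qed
  obtain m :: nat where m: "0 < m" "M / d < real m powr (1 - 1 / p)"
    using nat_powr_unbounded[of "1 - 1 / p" "M / d"] p_gt_1 by auto
  have "real m = real m powr (1 - 1 / p) * real m powr (1 / p)"
    using m(1) by (simp flip: powr_add)
  then have "real m powr (1 - 1 / p) * d * real m powr (1 / p) \<le> M * real m powr (1 / p)"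
    using growth[of m] by (metis mult.assoc mult.commute)
  then have "real m powr (1 - 1 / p) * d \<le> M"
    using m(1) by simp
  then show False
    using m(2) d by (simp add: field_simps)
qed

section \<open>Lifted extensions\<close>

lemma compact_op_diff_comp_left:
  assumes "compact_op p (\<lambda>x. seq_diff (T x) (U x))" "bounded_op p V"
    and "\<And>x. x \<in> lp p \<Longrightarrow> T x \<in> lp p" "\<And>x. x \<in> lp p \<Longrightarrow> U x \<in> lp p"
  shows "compact_op p (\<lambda>x. seq_diff (V (T x)) (V (U x)))"
  by (rule compact_op_cong[OF compact_op_comp_left[OF assms(1,2)]])
    (simp add: bounded_op_diff_arg[OF assms(2)] assms(3,4))

text \<open>Infinitely many disjoint eigenvectors for each eigenvalue on a norming set of points keep
  the essential norm from dropping below the supremum norm.\<close>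

lemma trivial_ext_of_lift:
  fixes \<rho> :: "(real \<Rightarrow> complex) \<Rightarrow> bop" and t :: "nat \<Rightarrow> real"
  assumes bd: "\<And>f. f \<in> C01 \<Longrightarrow> bounded_op p (\<rho> f)"
    and add: "\<And>f g. f \<in> C01 \<Longrightarrow> g \<in> C01 \<Longrightarrow> op_eq p (\<rho> (\<lambda>t. f t + g t)) (op_add (\<rho> f) (\<rho> g))"
    and scale: "\<And>f c. f \<in> C01 \<Longrightarrow> op_eq p (\<rho> (\<lambda>t. c * f t)) (op_scale c (\<rho> f))"
    and mult: "\<And>f g. f \<in> C01 \<Longrightarrow> g \<in> C01 \<Longrightarrow> op_eq p (\<rho> (\<lambda>t. f t * g t)) (\<rho> f \<circ> \<rho> g)"
    and one: "op_eq p (\<rho> (\<lambda>t. 1)) id"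
    and upper: "\<And>f. f \<in> C01 \<Longrightarrow> opnorm p (\<rho> f) \<le> C * supnorm f"
    and eigen: "\<And>i. \<exists>x :: nat \<Rightarrow> seq. (\<forall>n. x n \<in> lp p \<and> lpnorm p (x n) = 1) \<and>
      (\<forall>m n k. m \<noteq> n \<longrightarrow> x m k = 0 \<or> x n k = 0) \<and>
      (\<forall>f\<in>C01. \<forall>n. \<rho> f (x n) = seq_scale (f (t i)) (x n))"
    and norming: "\<And>f B. f \<in> C01 \<Longrightarrow> (\<And>i. cmod (f (t i)) \<le> B) \<Longrightarrow> supnorm f \<le> B"
  shows "trivial_ext p (\<lambda>f. calkin_pi p (\<rho> f))"
proof -
  \<comment> \<open>Proved for every representative \<open>T\<close> of the class: the choice T =
    \<open>\<rho> f\<close> bounds the lift from below, and the infimum over T bounds the Calkin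
    norm, both with constant 1.\<close>
  have lower: "supnorm f \<le> opnorm p T" if f: "f \<in> C01" and T: "T \<in> calkin_pi p (\<rho> f)" for f T
  proof (rule norming[OF f], rule field_le_epsilon)
    fix i and e :: real
    assume "0 < e"
    have bT: "bounded_op p T" and K: "compact_op p (\<lambda>x. seq_diff (T x) (\<rho> f x))"
      using T by (auto simp: calkin_pi_def)
    obtain x :: "nat \<Rightarrow> seq" where x: "\<And>n. x n \<in> lp p" "\<And>n. lpnorm p (x n) = 1"
      "\<And>m n k. m \<noteq> n \<Longrightarrow> x m k = 0 \<or> x n k = 0" "\<And>n. \<rho> f (x n) = seq_scale (f (t i)) (x n)"
      using eigen[of i] f by metis
    have "finite {n. e \<le> lpnorm p (seq_diff (T (x n)) (\<rho> f (x n)))}"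
      by (rule compact_op_disjoint_sequence[OF K x(1-3) \<open>0 < e\<close>])
    then obtain n where n: "lpnorm p (seq_diff (T (x n)) (\<rho> f (x n))) < e"
      using infinite_UNIV_nat by (metis (mono_tags, lifting) UNIV_eq_I mem_Collect_eq not_le)
    have in_lp: "T (x n) \<in> lp p" "\<rho> f (x n) \<in> lp p"
      using bounded_opD(1)[OF bT x(1)] bounded_opD(1)[OF bd[OF f] x(1)] by auto
    have "cmod (f (t i)) = lpnorm p (\<rho> f (x n))"
      using lpnorm_scale[OF x(1)] x(2) by (simp add: x(4))
    also have "\<dots> \<le> lpnorm p (seq_diff (T (x n)) (\<rho> f (x n))) + lpnorm p (T (x n))"
      using lpnorm_le_diff_add[OF in_lp(2,1)] lpnorm_diff_commute[OF in_lp] by simp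
    also have "\<dots> \<le> e + opnorm p T"
      using n lpnorm_le_opnorm[OF bT x(1)] x(2) by (intro add_mono) auto
    finally show "cmod (f (t i)) \<le> opnorm p T + e"
      by simp
  qed
  have cn_lower: "supnorm f \<le> calkin_norm p (calkin_pi p (\<rho> f))" if "f \<in> C01" for f
    unfolding calkin_norm_def
    using lower[OF that] calkin_pi_self[OF bd[OF that]] by (intro cINF_greatest) auto
  have cn_upper: "calkin_norm p (calkin_pi p (\<rho> f)) \<le> C * supnorm f" if "f \<in> C01" for f
  proof -
    \<comment> \<open>An infimum lies below a member once the set is bounded below;
      \<open>lower\<close> supplies that bound.\<close>
    have "calkin_norm p (calkin_pi p (\<rho> f)) \<le> opnorm p (\<rho> f)"
      unfolding calkin_norm_def
      using lower[OF that] calkin_pi_self[OF bd[OF that]]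
      by (intro cINF_lower bdd_belowI2[of _ "supnorm f"]) auto
    then show ?thesis
      using upper[OF that] by linarith
  qed
  have "iso_lift p \<rho>"
    unfolding iso_lift_def
    using bd add scale mult one lower[OF _ calkin_pi_self[OF bd]] upper
    by (intro conjI exI[of _ 1] exI[of _ C]) auto
  moreover have "iso_ext p (\<lambda>f. calkin_pi p (\<rho> f))"
    unfolding iso_ext_def
  proof (intro conjI ballI allI)
    fix f
    assume f: "f \<in> C01"
    note rf = rep_calkin_pi[OF bd[OF f]]
    let ?A = "rep (calkin_pi p (\<rho> f))"
    show "calkin_pi p (\<rho> f) \<in> calkin p"
      using bd[OF f] by (auto simp: calkin_def)
    show "calkin_pi p (\<rho> (\<lambda>t. c * f t)) = calkin_pi p (op_scale c ?A)" for c
    proof (rule calkin_pi_eqI)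
      show "compact_op p (\<lambda>x. seq_diff (\<rho> (\<lambda>t. c * f t) x) (op_scale c ?A x))"
        by (rule compact_op_cong[OF compact_op_scale[OF rf(2), of "- c"]])
          (use scale[OF f, of c] in \<open>auto simp: op_eq_def op_scale_def seq_scale_def seq_diff_def algebra_simps\<close>)
    qed
    fix g
    assume g: "g \<in> C01"
    note rg = rep_calkin_pi[OF bd[OF g]]
    let ?B = "rep (calkin_pi p (\<rho> g))"
    show "calkin_pi p (\<rho> (\<lambda>t. f t + g t)) = calkin_pi p (op_add ?A ?B)"
    proof (rule calkin_pi_eqI)
      show "compact_op p (\<lambda>x. seq_diff (\<rho> (\<lambda>t. f t + g t) x) (op_add ?A ?B x))"
        by (rule compact_op_cong[OF compact_op_scale[OF compact_op_add[OF rf(2) rg(2)], of "- 1"]])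
          (use add[OF f g] in \<open>auto simp: op_eq_def op_add_def seq_add_def seq_scale_def seq_diff_def algebra_simps\<close>)
    qed
    show "calkin_pi p (\<rho> (\<lambda>t. f t * g t)) = calkin_pi p (?A \<circ> ?B)"
    proof (rule calkin_pi_eqI, rule compact_op_diff_commute)
      \<comment> \<open>With R and S the lifts of f and g, the difference A B - R S splits as (A -
        R) B + R (B - S).\<close>
      have 1: "compact_op p (\<lambda>x. seq_diff (?A (?B x)) (\<rho> f (?B x)))"
        by (rule compact_op_comp_right[OF rf(2) rg(1)])
      have 2: "compact_op p (\<lambda>x. seq_diff (\<rho> f (?B x)) (\<rho> f (\<rho> g x)))"
        by (rule compact_op_diff_comp_left[OF rg(2) bd[OF f]])
          (auto simp: bounded_opD rg(1) bd[OF g])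
      show "compact_op p (\<lambda>x. seq_diff ((?A \<circ> ?B) x) (\<rho> (\<lambda>t. f t * g t) x))"
        by (rule compact_op_cong[OF compact_op_diff_trans[OF 1 2]])
          (use mult[OF f g] in \<open>auto simp: op_eq_def\<close>)
    qed
  next
    have "(0::real) < 1 \<and> (\<forall>f\<in>C01. 1 * supnorm f \<le> calkin_norm p (calkin_pi p (\<rho> f)) \<and>
        calkin_norm p (calkin_pi p (\<rho> f)) \<le> C * supnorm f)"
      using cn_lower cn_upper by simp
    then show "\<exists>c C. c > 0 \<and> (\<forall>f\<in>C01. c * supnorm f \<le> calkin_norm p (calkin_pi p (\<rho> f)) \<and>
        calkin_norm p (calkin_pi p (\<rho> f)) \<le> C * supnorm f)"
      by blast
    show "calkin_pi p (\<rho> (\<lambda>t. 1)) = calkin_pi p id"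
      by (rule calkin_pi_eqI, rule compact_op_cong[OF compact_op_zero])
        (use one in \<open>auto simp: op_eq_def seq_diff_def\<close>)
  qed
  ultimately show ?thesis
    unfolding trivial_ext_def by blast
qed

section \<open>Intertwiners modulo compact operators\<close>

text \<open>Multiplying S A Sinv - D by Sinv on the left and W on the right shows that A (Sinv W)
  and (Sinv W) B agree modulo compact operators, since D W = W B holds exactly. The representatives
  A and B are then exchanged for the lifts R1 and R2. W will be the identity for a plain equivalence
  and the embedding of the first summand for a sum.\<close>

lemma compact_intertwiner:
  assumes bd: "bounded_op p S" "bounded_op p Sinv" "bounded_op p W" "bounded_op p A" "bounded_op p B"
      "bounded_op p R1" "bounded_op p R2"
    and inv: "op_eq p (Sinv \<circ> S) id"
    and SD: "compact_op p (\<lambda>x. seq_diff (S (A (Sinv x))) (D x))"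
    and DW: "\<And>x. x \<in> lp p \<Longrightarrow> D (W x) = W (B x)"
    and A: "compact_op p (\<lambda>x. seq_diff (A x) (R1 x))"
    and B: "compact_op p (\<lambda>x. seq_diff (B x) (R2 x))"
  shows "compact_op p (\<lambda>x. seq_diff (Sinv (W (R2 x))) (R1 (Sinv (W x))))"
proof -
  note in_lp = bd[THEN bounded_opD(1)]
  have "compact_op p (\<lambda>x. seq_diff (S (A (Sinv (W x)))) (D (W x)))"
    by (rule compact_op_comp_right[OF SD bd(3)])
  then have "compact_op p (\<lambda>x. seq_diff (S (A (Sinv (W x)))) (W (B x)))"
    by (rule compact_op_cong) (simp add: DW)
  then have "compact_op p (\<lambda>x. seq_diff (Sinv (S (A (Sinv (W x))))) (Sinv (W (B x))))"
    by (rule compact_op_diff_comp_left[OF _ bd(2)]) (auto simp: in_lp)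
  then have "compact_op p (\<lambda>x. seq_diff (A (Sinv (W x))) (Sinv (W (B x))))"
    by (rule compact_op_cong) (use inv in \<open>auto simp: op_eq_def in_lp\<close>)
  then have 1: "compact_op p (\<lambda>x. seq_diff (Sinv (W (B x))) (A (Sinv (W x))))"
    by (rule compact_op_diff_commute)
  have "compact_op p (\<lambda>x. seq_diff (W (R2 x)) (W (B x)))"
    by (rule compact_op_diff_comp_left[OF compact_op_diff_commute[OF B] bd(3)])
      (auto simp: in_lp)
  then have 2: "compact_op p (\<lambda>x. seq_diff (Sinv (W (R2 x))) (Sinv (W (B x))))"
    by (rule compact_op_diff_comp_left[OF _ bd(2)]) (auto simp: in_lp)
  have 3: "compact_op p (\<lambda>x. seq_diff (A (Sinv (W x))) (R1 (Sinv (W x))))"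
    by (rule compact_op_comp_right[OF A bounded_op_comp[OF bd(2,3)]])
  show ?thesis
    by (rule compact_op_diff_trans[OF 2 compact_op_diff_trans[OF 1 3]])
qed

section \<open>Embedding the first summand, and bounds from below\<close>

lemma interleave_zero:
  assumes "u \<in> lp p"
  shows "interleave u (\<lambda>n. 0) \<in> lp p" "lpnorm p (interleave u (\<lambda>n. 0)) = lpnorm p u"
proof -
  let ?v = "\<lambda>n. cmod (interleave u (\<lambda>n. 0) n) powr p"
  have mono: "strict_mono (\<lambda>n::nat. 2 * n)"
    by (simp add: strict_mono_def)
  have zero: "?v n = 0" if "n \<notin> range (\<lambda>n. 2 * n)" for n
    using that by (auto simp: interleave_def elim!: evenE)
  have eq: "(\<lambda>n. ?v (2 * n)) = (\<lambda>n. cmod (u n) powr p)"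
    by (simp add: interleave_def)
  show "interleave u (\<lambda>n. 0) \<in> lp p"
    using summable_mono_reindex[of "\<lambda>n. 2 * n" ?v, OF mono zero] assms unfolding eq lp_def by simp
  show "lpnorm p (interleave u (\<lambda>n. 0)) = lpnorm p u"
    using suminf_mono_reindex[of "\<lambda>n. 2 * n" ?v, OF mono zero] unfolding eq lpnorm_def by simp
qed

lemma bounded_op_interleave_zero: "bounded_op p (\<lambda>u. interleave u (\<lambda>n. 0))"
  unfolding bounded_op_def
  by (auto simp: interleave_zero intro!: exI[of _ 1]) (auto simp: interleave_def seq_add_def seq_scale_def)

text \<open>The composite of S and V only has to preserve norms: for a sum of extensions it is the
  isometric embedding of the first summand instead of the identity.\<close>

lemma bounded_below_of_left_inverse:
  assumes "bounded_op p S" "\<And>x. x \<in> lp p \<Longrightarrow> V x \<in> lp p"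
    and "\<And>x. x \<in> lp p \<Longrightarrow> lpnorm p (S (V x)) = lpnorm p x"
  shows "\<exists>c>0. \<forall>x\<in>lp p. c * lpnorm p x \<le> lpnorm p (V x)"
proof -
  obtain M where M: "0 < M" "\<And>x. x \<in> lp p \<Longrightarrow> lpnorm p (S x) \<le> M * lpnorm p x"
    using bounded_op_bound[OF assms(1)] by blast
  have "1 / M * lpnorm p x \<le> lpnorm p (V x)" if "x \<in> lp p" for x
    using M(2)[OF assms(2)[OF that]] assms(3)[OF that] M(1) by (simp add: field_simps)
  then show ?thesis
    using M(1) by (intro exI[of _ "1 / M"]) simp
qed

lemma ext_equiv_imp_intertwiner:
  assumes bd: "\<And>f. f \<in> C01 \<Longrightarrow> bounded_op p (\<rho>1 f)" "\<And>f. f \<in> C01 \<Longrightarrow> bounded_op p (\<rho>2 f)"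
    and "ext_equiv p (\<lambda>f. calkin_pi p (\<rho>1 f)) (\<lambda>f. calkin_pi p (\<rho>2 f))"
  shows "\<exists>V. intertwiner p \<rho>1 \<rho>2 V"
proof -
  obtain S Sinv where S: "bounded_op p S" "bounded_op p Sinv" "op_eq p (S \<circ> Sinv) id"
    "op_eq p (Sinv \<circ> S) id"
    and eq: "\<And>f. f \<in> C01 \<Longrightarrow> calkin_pi p (\<rho>2 f) = calkin_pi p (S \<circ> rep (calkin_pi p (\<rho>1 f)) \<circ> Sinv)"
    using assms(3) unfolding ext_equiv_def by blast
  have "compact_op p (\<lambda>x. seq_diff (Sinv (\<rho>2 f x)) (\<rho>1 f (Sinv x)))" if f: "f \<in> C01" for f
  proof (rule compact_intertwiner[where W = "\<lambda>x. x" and D = "\<rho>2 f" and B = "\<rho>2 f"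
        and A = "rep (calkin_pi p (\<rho>1 f))" and S = S and Sinv = Sinv])
    show "compact_op p (\<lambda>x. seq_diff (S (rep (calkin_pi p (\<rho>1 f)) (Sinv x))) (\<rho>2 f x))"
      using compact_op_diff_commute[OF calkin_pi_eqD[OF eq[OF f] bd(2)[OF f]]] by simp
    show "compact_op p (\<lambda>x. seq_diff (\<rho>2 f x) (\<rho>2 f x))"
      using compact_op_zero by (simp add: seq_diff_def)
  qed (use S bd f rep_calkin_pi[OF bd(1)[OF f]] bounded_op_id in auto)
  moreover have "\<exists>c>0. \<forall>x\<in>lp p. c * lpnorm p x \<le> lpnorm p (Sinv x)"
    using S bounded_opD(1)[OF S(2)]
    by (intro bounded_below_of_left_inverse[OF S(1)]) (auto simp: op_eq_def)
  ultimately show ?thesis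
    using S(2) unfolding intertwiner_def by blast
qed

text \<open>The intertwiner is \<open>Sinv\<close> on the even coordinates, where the first summand
  lives. A linear map kills 0, so on vectors supported there the direct sum acts through its first
  summand alone, whatever \<open>\<phi>\<close> is.\<close>

lemma ext_equiv_sum_imp_intertwiner:
  assumes bd: "\<And>f. f \<in> C01 \<Longrightarrow> bounded_op p (\<rho>1 f)" "\<And>f. f \<in> C01 \<Longrightarrow> bounded_op p (\<rho>2 f)"
    and "iso_ext p \<phi>"
    and "ext_equiv p (\<lambda>f. calkin_pi p (\<rho>1 f)) (ext_sum p (\<lambda>f. calkin_pi p (\<rho>2 f)) \<phi>)"
  shows "\<exists>V. intertwiner p \<rho>1 \<rho>2 V"
proof -
  let ?W = "\<lambda>u. interleave u (\<lambda>n. 0)"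
  obtain S Sinv where S: "bounded_op p S" "bounded_op p Sinv" "op_eq p (S \<circ> Sinv) id"
    "op_eq p (Sinv \<circ> S) id"
    and eq: "\<And>f. f \<in> C01 \<Longrightarrow> calkin_pi p (op_dsum (rep (calkin_pi p (\<rho>2 f))) (rep (\<phi> f))) =
      calkin_pi p (S \<circ> rep (calkin_pi p (\<rho>1 f)) \<circ> Sinv)"
    using assms(4) unfolding ext_equiv_def ext_sum_def by blast
  have "compact_op p (\<lambda>x. seq_diff (Sinv (?W (\<rho>2 f x))) (\<rho>1 f (Sinv (?W x))))" if f: "f \<in> C01" for f
  proof (rule compact_intertwiner[where W = ?W and B = "rep (calkin_pi p (\<rho>2 f))"
        and D = "op_dsum (rep (calkin_pi p (\<rho>2 f))) (rep (\<phi> f))"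
        and A = "rep (calkin_pi p (\<rho>1 f))" and S = S and Sinv = Sinv])
    note r1 = rep_calkin_pi[OF bd(1)[OF f]]
    have "bounded_op p (\<lambda>x. S (rep (calkin_pi p (\<rho>1 f)) (Sinv x)))"
      by (intro bounded_op_comp[OF S(1)] bounded_op_comp[OF r1(1)] S)
    then show "compact_op p (\<lambda>x. seq_diff (S (rep (calkin_pi p (\<rho>1 f)) (Sinv x)))
        (op_dsum (rep (calkin_pi p (\<rho>2 f))) (rep (\<phi> f)) x))"
      using calkin_pi_eqD[OF eq[OF f, symmetric]] by (simp add: o_def)
    obtain T where "bounded_op p T" "\<phi> f = calkin_pi p T"
      using assms(3) f by (auto simp: iso_ext_def calkin_def)
    then have "bounded_op p (rep (\<phi> f))"
      using rep_calkin_pi(1) by simp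
    then have zero: "rep (\<phi> f) (\<lambda>n. 0) = (\<lambda>n. 0)"
      by (rule bounded_op_zero_arg)
    have "evens (?W x) = x" "odds (?W x) = (\<lambda>n. 0)" for x
      by (auto simp: evens_def odds_def interleave_def)
    then show "op_dsum (rep (calkin_pi p (\<rho>2 f))) (rep (\<phi> f)) (?W x) = ?W (rep (calkin_pi p (\<rho>2 f)) x)" for x
      by (simp add: op_dsum_def zero)
  qed (use S bd f rep_calkin_pi[OF bd(1)[OF f]] rep_calkin_pi[OF bd(2)[OF f]]
      bounded_op_interleave_zero in auto)
  moreover have "bounded_op p (\<lambda>x. Sinv (?W x))"
    by (rule bounded_op_comp[OF S(2) bounded_op_interleave_zero])
  moreover have "\<exists>c>0. \<forall>x\<in>lp p. c * lpnorm p x \<le> lpnorm p (Sinv (?W x))"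
    using S bounded_opD(1)[OF S(2)]
    by (intro bounded_below_of_left_inverse[OF S(1)]) (auto simp: op_eq_def interleave_zero)
  ultimately show ?thesis
    unfolding intertwiner_def by blast
qed

section \<open>Norm estimates for the multipliers\<close>

lemma lpnorm_eq_one: "lpnorm p x powr p = 1 \<Longrightarrow> lpnorm p x = 1"
  using p_gt_1 powr_powr[of "lpnorm p x" p "1 / p"] by simp

lemma lp_finite_support:
  assumes "finite A" "\<And>m. m \<notin> A \<Longrightarrow> x m = 0"
  shows "x \<in> lp p" "lpnorm p x powr p = (\<Sum>m\<in>A. cmod (x m) powr p)"
proof -
  have "(\<lambda>m. cmod (x m) powr p) sums (\<Sum>m\<in>A. cmod (x m) powr p)"
    by (rule sums_finite) (use assms in auto)
  then show "x \<in> lp p" "lpnorm p x powr p = (\<Sum>m\<in>A. cmod (x m) powr p)"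
    by (auto simp: lp_def sums_iff lpnorm_powr)
qed

text \<open>On each block the map factors through l2: the coefficient bound, multiplication by c,
  and Khintchine back into lp. The factors 1 / 2^n and 2^n cancel, so one constant serves all
  blocks.\<close>

lemma rad_part_bounded:
  "\<exists>K>0. \<forall>c M. \<forall>x\<in>lp p. (\<forall>i. cmod (c i) \<le> M) \<longrightarrow>
    rad_part c x \<in> lp p \<and> lpnorm p (rad_part c x) \<le> K * M * lpnorm p x"
proof -
  obtain K1 where K1: "0 < K1" "\<And>n (a :: nat \<Rightarrow> complex).
    (\<Sum>m\<in>block n. cmod (\<Sum>i<n. a i * rademacher i m) powr p) \<le>
    K1 * 2 ^ n * (\<Sum>i<n. (cmod (a i))\<^sup>2) powr (p / 2)"
    using khintchine[of p] p_gt_1 by auto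
  obtain K2 where K2: "0 < K2" "\<And>n x. (\<Sum>i<n. (cmod (rcoef n i x))\<^sup>2) powr (p / 2) \<le>
    K2 / 2 ^ n * (\<Sum>m\<in>block n. cmod (x m) powr p)"
    using sum_rcoef_le[OF p_gt_1] by auto
  define K where "K = (K1 * K2) powr (1 / p)"
  have K: "0 < K" "K powr p = K1 * K2"
    using K1(1) K2(1) p_gt_1 by (auto simp: K_def powr_powr)
  have "rad_part c x \<in> lp p \<and> lpnorm p (rad_part c x) \<le> K * M * lpnorm p x"
    if x: "x \<in> lp p" and c: "\<And>i. cmod (c i) \<le> M" for c M x
  proof -
    have M: "0 \<le> M"
      using c[of 0] norm_ge_zero[of "c 0"] by linarith
    have on_block: "(\<Sum>m\<in>block n. cmod (rad_part c x m) powr p) \<le>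
        (K * M) powr p * (\<Sum>m\<in>block n. cmod (x m) powr p)" for n
    proof -
      let ?S = "\<Sum>i<n. (cmod (rcoef n i x))\<^sup>2"
      have "(\<Sum>i<n. (cmod (c i * rcoef n i x))\<^sup>2) \<le> (\<Sum>i<n. M\<^sup>2 * (cmod (rcoef n i x))\<^sup>2)"
        unfolding norm_mult power_mult_distrib
        by (intro sum_mono mult_right_mono power_mono c) auto
      then have "(\<Sum>i<n. (cmod (c i * rcoef n i x))\<^sup>2) powr (p / 2) \<le> (M\<^sup>2 * ?S) powr (p / 2)"
        using p_gt_1 by (intro powr_mono2) (auto simp: sum_nonneg simp flip: sum_distrib_left)
      also have "\<dots> = M powr p * ?S powr (p / 2)"
        using M by (simp add: powr_mult sum_nonneg power2_eq_square flip: powr_add)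
      also have "\<dots> \<le> M powr p * (K2 / 2 ^ n * (\<Sum>m\<in>block n. cmod (x m) powr p))"
        by (intro mult_left_mono K2(2)) auto
      finally have "K1 * 2 ^ n * (\<Sum>i<n. (cmod (c i * rcoef n i x))\<^sup>2) powr (p / 2) \<le>
          K1 * 2 ^ n * (M powr p * (K2 / 2 ^ n * (\<Sum>m\<in>block n. cmod (x m) powr p)))"
        using K1(1) by (intro mult_left_mono) auto
      also have "\<dots> = (K * M) powr p * (\<Sum>m\<in>block n. cmod (x m) powr p)"
        using K M by (simp add: powr_mult)
      finally show ?thesis
        using K1(2)[where n = n and a = "\<lambda>i. c i * rcoef n i x"] by (simp add: rad_part_def level_block)
    qed
    \<comment> \<open>The indices below 2^N are 0, where \<open>rad_part\<close> vanishes, and the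
      blocks before N, so the blockwise estimate can be summed.\<close>
    have dyadic: "(\<Sum>m<2 ^ N. cmod (rad_part c x m) powr p) \<le>
        (K * M) powr p * (\<Sum>m<(2::nat) ^ N. cmod (x m) powr p)" for N
    proof (induction N)
      case 0
      show ?case
        by (simp add: rad_part_def)
    next
      case (Suc N)
      have "{..<2 ^ N} \<inter> block N = {}"
        by (auto simp: block_def)
      then show ?case
        unfolding lessThan_power2_Suc using Suc on_block[of N]
        by (simp add: sum.union_disjoint distrib_left)
    qed
    have "(\<Sum>m<N. cmod (rad_part c x m) powr p) \<le> (K * M * lpnorm p x) powr p" for N
    proof -
      have "N \<le> 2 ^ N"
        by (simp add: less_imp_le)
      then have "(\<Sum>m<N. cmod (rad_part c x m) powr p) \<le> (\<Sum>m<2 ^ N. cmod (rad_part c x m) powr p)"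
        by (intro sum_mono2) auto
      also have "\<dots> \<le> (K * M) powr p * (\<Sum>m<(2::nat) ^ N. cmod (x m) powr p)"
        by (rule dyadic)
      also have "\<dots> \<le> (K * M) powr p * (lpnorm p x powr p)"
        using x unfolding lpnorm_powr[OF x]
        by (intro mult_left_mono sum_le_suminf) (auto simp: lp_def)
      finally show ?thesis
        using K M by (simp add: powr_mult)
    qed
    then show ?thesis
      using lpnorm_le_of_sums[of "rad_part c x" "K * M * lpnorm p x"] K M by simp
  qed
  then show ?thesis
    using K(1) by blast
qed

lemma rad_op_bounded:
  "\<exists>K>0. \<forall>c M. (\<forall>i. cmod (c i) \<le> M) \<longrightarrow> bounded_op p (rad_op c) \<and> opnorm p (rad_op c) \<le> K * M"
proof -
  obtain K where K: "0 < K" "\<And>c M x. x \<in> lp p \<Longrightarrow> (\<And>i. cmod (c i) \<le> M) \<Longrightarrow>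
      rad_part c x \<in> lp p \<and> lpnorm p (rad_part c x) \<le> K * M * lpnorm p x"
    using rad_part_bounded by blast
  \<comment> \<open>The scalar part costs M, and the differences \<open>c i - c 0\<close> are
    bounded by 2M.\<close>
  have "bounded_op p (rad_op c) \<and> opnorm p (rad_op c) \<le> (1 + 2 * K) * M"
    if c: "\<And>i. cmod (c i) \<le> M" for c M
  proof -
    have M: "0 \<le> M"
      using c[of 0] norm_ge_zero[of "c 0"] by linarith
    have "cmod (c i - c 0) \<le> 2 * M" for i
      using norm_triangle_ineq4[of "c i" "c 0"] c[of i] c[of 0] by linarith
    then have part: "rad_part (\<lambda>i. c i - c 0) x \<in> lp p"
      "lpnorm p (rad_part (\<lambda>i. c i - c 0) x) \<le> K * (2 * M) * lpnorm p x" if "x \<in> lp p" for x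
      using K(2)[OF that, of "\<lambda>i. c i - c 0" "2 * M"] by auto
    have in_lp: "rad_op c x \<in> lp p" if "x \<in> lp p" for x
      unfolding rad_op_def using that by (intro lp_add lp_scale part)
    have bound: "lpnorm p (rad_op c x) \<le> (1 + 2 * K) * M * lpnorm p x" if x: "x \<in> lp p" for x
    proof -
      have "lpnorm p (rad_op c x) \<le> cmod (c 0) * lpnorm p x + K * (2 * M) * lpnorm p x"
        unfolding rad_op_def
        using lpnorm_add_le[OF lp_scale[OF x] part(1)[OF x], of "c 0"] part(2)[OF x]
        by (simp add: lpnorm_scale[OF x])
      also have "\<dots> \<le> M * lpnorm p x + K * (2 * M) * lpnorm p x"
        using c by (intro add_right_mono mult_right_mono) auto
      finally show ?thesis
        by (simp add: algebra_simps)
    qed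
    have "bounded_op p (rad_op c)"
      unfolding bounded_op_def using in_lp bound by (auto simp: rad_op_seq_add rad_op_seq_scale)
    then show ?thesis
      using opnorm_le[OF bound] K(1) M by simp
  qed
  then show ?thesis
    using K(1) by (intro exI[of _ "1 + 2 * K"]) auto
qed

lemma diag_op_bounded:
  assumes "\<And>i. cmod (c i) \<le> M"
  shows "bounded_op p (diag_op c)" "opnorm p (diag_op c) \<le> M"
proof -
  have M: "0 \<le> M"
    using assms[of 0] norm_ge_zero[of "c 0"] by linarith
  have *: "diag_op c x \<in> lp p" "lpnorm p (diag_op c x) \<le> M * lpnorm p x" if x: "x \<in> lp p" for x
  proof -
    have "(\<Sum>m<N. cmod (diag_op c x m) powr p) \<le> (M * lpnorm p x) powr p" for N
    proof -
      have "(\<Sum>m<N. cmod (diag_op c x m) powr p) \<le> (\<Sum>m<N. M powr p * cmod (x m) powr p)"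
        unfolding diag_op_def norm_mult powr_mult
        using assms p_gt_1 by (intro sum_mono mult_right_mono powr_mono2) auto
      also have "\<dots> \<le> M powr p * lpnorm p x powr p"
        using x unfolding lpnorm_powr[OF x] sum_distrib_left[symmetric]
        by (intro mult_left_mono sum_le_suminf) (auto simp: lp_def)
      finally show ?thesis
        using M by (simp add: powr_mult)
    qed
    then show "diag_op c x \<in> lp p" "lpnorm p (diag_op c x) \<le> M * lpnorm p x"
      using lpnorm_le_of_sums[of "diag_op c x" "M * lpnorm p x"] M by auto
  qed
  then show "bounded_op p (diag_op c)"
    unfolding bounded_op_def by (auto simp: diag_op_def seq_add_def seq_scale_def algebra_simps)
  show "opnorm p (diag_op c) \<le> M"
    using opnorm_le[OF *(2) M] .
qed

text \<open>Khintchine gives the upper estimate, and the coefficient bound for the same vector gives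
  the lower one. The condition N <= n keeps the indices in the range where the signs are independent
  on the block.\<close>

lemma rvec_sum_norm:
  "\<exists>c>0. \<exists>C>0. \<forall>n N. N \<le> n \<longrightarrow>
    c * real N powr (1 / 2) \<le> lpnorm p (\<lambda>m. \<Sum>j<N. rvec p n j m) \<and>
    lpnorm p (\<lambda>m. \<Sum>j<N. rvec p n j m) \<le> C * real N powr (1 / 2)"
proof -
  obtain K1 where K1: "0 < K1" "\<And>n (a :: nat \<Rightarrow> complex).
    (\<Sum>m\<in>block n. cmod (\<Sum>i<n. a i * rademacher i m) powr p) \<le>
    K1 * 2 ^ n * (\<Sum>i<n. (cmod (a i))\<^sup>2) powr (p / 2)"
    using khintchine[of p] p_gt_1 by auto
  obtain K2 where K2: "0 < K2" "\<And>n x. (\<Sum>i<n. (cmod (rcoef n i x))\<^sup>2) powr (p / 2) \<le>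
    K2 / 2 ^ n * (\<Sum>m\<in>block n. cmod (x m) powr p)"
    using sum_rcoef_le[OF p_gt_1] by auto
  have "real N powr (p / 2) \<le> K2 * lpnorm p (\<lambda>m. \<Sum>j<N. rvec p n j m) powr p \<and>
      lpnorm p (\<lambda>m. \<Sum>j<N. rvec p n j m) powr p \<le> K1 * real N powr (p / 2)" if "N \<le> n" for n N
  proof -
    define x where "x = (\<lambda>m. \<Sum>j<N. rvec p n j m)"
    define a :: "nat \<Rightarrow> complex" where "a i = (if i < N then 1 / 2 powr (n / p) else 0)" for i
    have x_norm: "lpnorm p x powr p = (\<Sum>m\<in>block n. cmod (x m) powr p)"
      by (rule lp_finite_support(2)) (auto simp: x_def rvec_def)
    have x_block: "x m = (\<Sum>i<n. a i * rademacher i m)" if "m \<in> block n" for m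
    proof -
      have "(\<Sum>i<n. a i * rademacher i m) = (\<Sum>i<N. a i * rademacher i m)"
        by (rule sum.mono_neutral_right) (use \<open>N \<le> n\<close> in \<open>auto simp: a_def\<close>)
      then show ?thesis
        using that by (simp add: x_def a_def rvec_def)
    qed
    have "(\<Sum>i<n. (cmod (a i))\<^sup>2) = (\<Sum>i<N. (cmod (a i))\<^sup>2)"
      by (rule sum.mono_neutral_right) (use \<open>N \<le> n\<close> in \<open>auto simp: a_def\<close>)
    then have "(\<Sum>i<n. (cmod (a i))\<^sup>2) = real N * (1 / 2 powr (n / p))\<^sup>2"
      by (simp add: a_def norm_divide)
    moreover have "((1 / 2 powr (n / p))\<^sup>2) powr (p / 2) = 1 / 2 ^ n"
      using p_gt_1 by (simp add: power2_eq_square powr_mult powr_divide powr_powr powr_realpow flip: powr_add)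
    ultimately have a_norm: "(\<Sum>i<n. (cmod (a i))\<^sup>2) powr (p / 2) = real N powr (p / 2) / 2 ^ n"
      by (simp add: powr_mult)
    have "rcoef n i x = a i" if "i < n" for i
      by (rule rcoef_expansion[OF that x_block])
    then have "(\<Sum>i<n. (cmod (a i))\<^sup>2) powr (p / 2) \<le> K2 / 2 ^ n * lpnorm p x powr p"
      using K2(2)[of n x] by (simp add: x_norm)
    then have "real N powr (p / 2) \<le> K2 * lpnorm p x powr p"
      unfolding a_norm by (simp add: field_simps)
    moreover have "lpnorm p x powr p \<le> K1 * 2 ^ n * (real N powr (p / 2) / 2 ^ n)"
      using K1(2)[where a = a and n = n] unfolding a_norm x_norm by (simp add: x_block)
    ultimately show ?thesis
      by (simp add: x_def)
  qed
  note powers = this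
  have root: "u \<le> w powr (1 / p) * v" if "u powr p \<le> w * v powr p" "0 \<le> u" "0 \<le> v" "0 \<le> w" for u v w :: real
  proof -
    have "(u powr p) powr (1 / p) \<le> (w * v powr p) powr (1 / p)"
      using that p_gt_1 by (intro powr_mono2) auto
    then show ?thesis
      using that p_gt_1 by (simp add: powr_mult powr_powr)
  qed
  have half: "(real N powr (1 / 2)) powr p = real N powr (p / 2)" for N
    by (simp add: powr_powr)
  have "1 / K2 powr (1 / p) * real N powr (1 / 2) \<le> lpnorm p (\<lambda>m. \<Sum>j<N. rvec p n j m) \<and>
      lpnorm p (\<lambda>m. \<Sum>j<N. rvec p n j m) \<le> K1 powr (1 / p) * real N powr (1 / 2)" if N: "N \<le> n" for n N
  proof -
    let ?x = "lpnorm p (\<lambda>m. \<Sum>j<N. rvec p n j m)"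
    have "real N powr (1 / 2) \<le> K2 powr (1 / p) * ?x"
      using powers[OF N] K2(1) by (intro root) (auto simp: half)
    moreover have "?x \<le> K1 powr (1 / p) * real N powr (1 / 2)"
      using powers[OF N] K1(1) by (intro root) (auto simp: half)
    ultimately show ?thesis
      using K2(1) by (simp add: field_simps)
  qed
  moreover have "0 < 1 / K2 powr (1 / p)" "0 < K1 powr (1 / p)"
    using K1(1) K2(1) by auto
  ultimately show ?thesis
    by blast
qed

lemma rvec_lp:
  shows "rvec p n i \<in> lp p" "lpnorm p (rvec p n i) = 1"
proof -
  have zero: "rvec p n i m = 0" if "m \<notin> block n" for m
    using that by (simp add: rvec_def)
  show "rvec p n i \<in> lp p"
    by (rule lp_finite_support(1)[OF finite_block zero])
  have "lpnorm p (rvec p n i) powr p = (\<Sum>m\<in>block n. cmod (rvec p n i m) powr p)"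
    by (rule lp_finite_support(2)[OF finite_block zero])
  also have "\<dots> = (\<Sum>m\<in>block n. 1 / 2 ^ n)"
    using p_gt_1 by (intro sum.cong) (auto simp: rvec_def norm_divide powr_divide powr_powr powr_realpow)
  finally have "lpnorm p (rvec p n i) powr p = 1"
    by simp
  then show "lpnorm p (rvec p n i) = 1"
    by (rule lpnorm_eq_one)
qed

section \<open>The two extensions\<close>

lemma cmod_rat_pt_le: "f \<in> C01 \<Longrightarrow> cmod (f (rat_pt i)) \<le> supnorm f"
  by (rule cmod_le_supnorm[OF _ rat_pt_mem])

lemma diag_lift_bounded: "f \<in> C01 \<Longrightarrow> bounded_op p (diag_op (\<lambda>i. f (rat_pt i)))"
  by (rule diag_op_bounded(1)[OF cmod_rat_pt_le])

lemma rad_lift_bounded: "f \<in> C01 \<Longrightarrow> bounded_op p (rad_op (\<lambda>i. f (rat_pt i)))"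
proof -
  obtain K where K: "\<And>c M. (\<And>i. cmod (c i) \<le> M) \<Longrightarrow> bounded_op p (rad_op c)"
    using rad_op_bounded by blast
  show "f \<in> C01 \<Longrightarrow> bounded_op p (rad_op (\<lambda>i. f (rat_pt i)))"
    by (rule K[OF cmod_rat_pt_le])
qed

lemma trivial_ext_diag: "trivial_ext p (\<lambda>f. calkin_pi p (diag_op (\<lambda>i. f (rat_pt i))))"
proof (rule trivial_ext_of_lift[where t = rat_pt and C = 1])
  show "opnorm p (diag_op (\<lambda>i. f (rat_pt i))) \<le> 1 * supnorm f" if "f \<in> C01" for f
    using diag_op_bounded(2)[OF cmod_rat_pt_le[OF that]] by simp
next
  fix i
  define x :: "nat \<Rightarrow> seq" where "x n = (\<lambda>m. if m = prod_encode (i, n) then 1 else 0)" for n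
  have "x n \<in> lp p \<and> lpnorm p (x n) = 1" for n
  proof -
    have zero: "x n m = 0" if "m \<notin> {prod_encode (i, n)}" for m
      using that by (simp add: x_def)
    have "lpnorm p (x n) powr p = (\<Sum>m\<in>{prod_encode (i, n)}. cmod (x n m) powr p)"
      by (rule lp_finite_support(2)[OF _ zero]) simp
    then have "lpnorm p (x n) powr p = 1"
      by (simp add: x_def)
    then show ?thesis
      using lp_finite_support(1)[of "{prod_encode (i, n)}" "x n"] zero lpnorm_eq_one
      by simp
  qed
  moreover have "x m k = 0 \<or> x n k = 0" if "m \<noteq> n" for m n k
    using that by (auto simp: x_def)
  moreover have "diag_op (\<lambda>i. f (rat_pt i)) (x n) = seq_scale (f (rat_pt i)) (x n)" for f n
    by (auto simp: diag_op_def seq_scale_def x_def)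
  ultimately show "\<exists>x :: nat \<Rightarrow> seq. (\<forall>n. x n \<in> lp p \<and> lpnorm p (x n) = 1) \<and>
      (\<forall>m n k. m \<noteq> n \<longrightarrow> x m k = 0 \<or> x n k = 0) \<and>
      (\<forall>f\<in>C01. \<forall>n. diag_op (\<lambda>i. f (rat_pt i)) (x n) = seq_scale (f (rat_pt i)) (x n))"
    by blast
qed (auto simp: diag_lift_bounded supnorm_le_rat_pt op_eq_def op_add_def op_scale_def diag_op_def
    seq_add_def seq_scale_def algebra_simps)

lemma rvec_disjoint: "m \<noteq> n \<Longrightarrow> rvec p m i k = 0 \<or> rvec p n j k = 0"
  using block_disjoint[of m n] by (auto simp: rvec_def)

lemma trivial_ext_rad: "trivial_ext p (\<lambda>f. calkin_pi p (rad_op (\<lambda>i. f (rat_pt i))))"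
proof -
  obtain K where K: "\<And>c M. (\<And>i. cmod (c i) \<le> M) \<Longrightarrow> opnorm p (rad_op c) \<le> K * M"
    using rad_op_bounded by blast
  show ?thesis
  proof (rule trivial_ext_of_lift[where t = rat_pt and C = K])
    show "opnorm p (rad_op (\<lambda>i. f (rat_pt i))) \<le> K * supnorm f" if "f \<in> C01" for f
      by (rule K[OF cmod_rat_pt_le[OF that]])
  next
    fix i
    show "\<exists>x :: nat \<Rightarrow> seq. (\<forall>n. x n \<in> lp p \<and> lpnorm p (x n) = 1) \<and>
        (\<forall>m n k. m \<noteq> n \<longrightarrow> x m k = 0 \<or> x n k = 0) \<and>
        (\<forall>f\<in>C01. \<forall>n. rad_op (\<lambda>i. f (rat_pt i)) (x n) = seq_scale (f (rat_pt i)) (x n))"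
      \<comment> \<open>The i-th Rademacher function is an eigenvector only on blocks with number
        above i, hence the shift by \<open>Suc i\<close>.\<close>
      by (rule exI[of _ "\<lambda>n. rvec p (Suc i + n) i"])
        (simp add: rvec_lp rad_op_rvec rvec_disjoint)
  qed (auto simp: rad_lift_bounded supnorm_le_rat_pt op_eq_def op_add_def op_scale_def
      rad_op_add rad_op_scale rad_op_mult rad_op_one)
qed

section \<open>Incompatible growth of Rademacher sums and of their images\<close>

lemma no_intertwiner:
  assumes "p \<noteq> 2"
  shows "\<not> intertwiner p (\<lambda>f. diag_op (\<lambda>i. f (rat_pt i))) (\<lambda>f. rad_op (\<lambda>i. f (rat_pt i))) V"
proof
  assume "intertwiner p (\<lambda>f. diag_op (\<lambda>i. f (rat_pt i))) (\<lambda>f. rad_op (\<lambda>i. f (rat_pt i))) V"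
  then obtain \<alpha> where V: "bounded_op p V"
    and \<alpha>: "0 < \<alpha>" "\<And>x. x \<in> lp p \<Longrightarrow> \<alpha> * lpnorm p x \<le> lpnorm p (V x)"
    and compact: "\<And>f. f \<in> C01 \<Longrightarrow> compact_op p (\<lambda>x. seq_diff (V (rad_op (\<lambda>i. f (rat_pt i)) x))
      (diag_op (\<lambda>i. f (rat_pt i)) (V x)))"
    unfolding intertwiner_def by auto
  obtain \<beta> where \<beta>: "0 < \<beta>" "\<And>x. x \<in> lp p \<Longrightarrow> lpnorm p (V x) \<le> \<beta> * lpnorm p x"
    using bounded_op_bound[OF V] by blast
  have "\<alpha> \<le> \<beta>"
    using \<alpha>(2)[of "rvec p 0 0"] \<beta>(2)[of "rvec p 0 0"] by (simp add: rvec_lp)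
  obtain c C where c: "0 < c" and C: "0 < C" and
    cC: "\<And>n N. N \<le> n \<Longrightarrow> c * real N powr (1 / 2) \<le> lpnorm p (\<lambda>m. \<Sum>j<N. rvec p n j m) \<and>
      lpnorm p (\<lambda>m. \<Sum>j<N. rvec p n j m) \<le> C * real N powr (1 / 2)"
    using rvec_sum_norm by blast
  \<comment> \<open>Both inequalities compare two estimates of the norm of \<open>V x\<close>, where
    x is a sum of N Rademacher vectors of one block: one through the norm of x, the other through
    the near disjointness of the images.\<close>
  have main: "\<alpha> / 2 * real N powr (1 / p) \<le> \<beta> * C * real N powr (1 / 2) \<and>
      \<alpha> * c * real N powr (1 / 2) \<le> 3 * \<beta> * real N powr (1 / p)" if N: "0 < N" for N
  proof -
    obtain f where f: "\<And>j. j < N \<Longrightarrow> f j \<in> C01" "\<And>j. j < N \<Longrightarrow> f j (rat_pt j) = 1"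
      "\<And>j k s. j < N \<Longrightarrow> k < N \<Longrightarrow> j \<noteq> k \<Longrightarrow> f j s = 0 \<or> f k s = 0"
      using disjoint_bumps[OF inj_rat_pt, of N] by metis
    \<comment> \<open>The tolerance for one vector: N such errors add up to \<alpha> / 4.\<close>
    define e where "e = \<alpha> / (4 * real N)"
    have e: "0 < e" "e \<le> \<alpha> / 4" "real N * e = \<alpha> / 4"
      using \<alpha>(1) N by (auto simp: e_def field_simps)
    define K where "K j x = seq_diff (V (rad_op (\<lambda>i. f j (rat_pt i)) x)) (diag_op (\<lambda>i. f j (rat_pt i)) (V x))"
      for j x
    have "finite {n. e \<le> lpnorm p (K j (rvec p (N + n) j))}" if "j < N" for j
      using compact[OF f(1)[OF that]] rvec_lp e(1)
      by (intro compact_op_disjoint_sequence rvec_disjoint) (auto simp: K_def)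
    then have "finite (\<Union>j<N. {n. e \<le> lpnorm p (K j (rvec p (N + n) j))})"
      by simp
    \<comment> \<open>One n0 serves all j < N, as each j excludes only finitely many blocks. The
      block number N + n0 is at least N, so all N vectors are genuine eigenvectors.\<close>
    then obtain n0 where n0: "n0 \<notin> (\<Union>j<N. {n. e \<le> lpnorm p (K j (rvec p (N + n) j))})"
      using ex_new_if_finite[OF infinite_UNIV_nat] by blast
    define v where "v j = rvec p (N + n0) j" for j
    \<comment> \<open>The image cut down to the coordinates whose point lies under bump j; distinct
      j leave disjoint supports.\<close>
    define Z where "Z j = diag_op (\<lambda>i. f j (rat_pt i)) (V (v j))" for j
    have v: "v j \<in> lp p" "lpnorm p (v j) = 1" for j
      by (auto simp: v_def rvec_lp)
    have Vv: "V (v j) \<in> lp p" "\<alpha> \<le> lpnorm p (V (v j))" "lpnorm p (V (v j)) \<le> \<beta>" for j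
      using bounded_opD(1)[OF V v(1)] \<alpha>(2)[OF v(1)] \<beta>(2)[OF v(1)] v(2) by auto
    have Z: "Z j \<in> lp p" if "j < N" for j
      unfolding Z_def using diag_lift_bounded[OF f(1)[OF that]] Vv(1) by (rule bounded_opD(1))
    \<comment> \<open>Bump j equals 1 at point j, so \<open>rad_op\<close> fixes \<open>v j\<close>,
      and the compact error is exactly what the cut removes.\<close>
    have "K j (v j) = seq_diff (V (v j)) (Z j)" if "j < N" for j
      using that f(2)[OF that] by (simp add: K_def Z_def v_def rad_op_rvec seq_scale_def)
    then have close: "lpnorm p (seq_diff (V (v j)) (Z j)) < e" if "j < N" for j
      using n0 that by (fastforce simp: v_def not_le)
    \<comment> \<open>The cut changes norms by less than e, and e <= \<alpha> / 4 <=
      \<beta>.\<close>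
    have Z_norm: "3 / 4 * \<alpha> \<le> lpnorm p (Z j)" "lpnorm p (Z j) \<le> 2 * \<beta>" if "j < N" for j
      using lpnorm_le_diff_add[OF Vv(1)[of j] Z[OF that]] lpnorm_le_diff_add[OF Z[OF that] Vv(1)[of j]]
        lpnorm_diff_commute[OF Vv(1)[of j] Z[OF that]] close[OF that] e(2) Vv(2,3)[of j] \<open>\<alpha> \<le> \<beta>\<close> \<alpha>(1)
      by linarith+
    define x where "x = (\<lambda>m. \<Sum>j<N. v j m)"
    define z where "z = (\<lambda>m. \<Sum>j<N. Z j m)"
    have x: "x \<in> lp p"
      unfolding x_def by (rule lp_sum) (auto simp: v)
    have z: "z \<in> lp p"
      unfolding z_def by (rule lp_sum) (auto simp: Z)
    have Vx: "V x = (\<lambda>m. \<Sum>j<N. V (v j) m)"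
      unfolding x_def by (rule bounded_op_sum_arg[OF V]) (auto simp: v)
    have "lpnorm p (\<lambda>m. \<Sum>j<N. seq_diff (V (v j)) (Z j) m) \<le> (\<Sum>j<N. lpnorm p (seq_diff (V (v j)) (Z j)))"
      by (rule lpnorm_sum_le) (auto simp: lp_diff Vv Z)
    also have "\<dots> \<le> (\<Sum>j<N. e)"
      using close by (intro sum_mono) (auto intro: less_imp_le)
    also have "(\<lambda>m. \<Sum>j<N. seq_diff (V (v j)) (Z j) m) = seq_diff (V x) z"
      by (simp add: Vx z_def seq_diff_def sum_subtractf)
    finally have diff: "lpnorm p (seq_diff (V x) z) \<le> \<alpha> / 4"
      using e(3) by simp
    have z_powr: "lpnorm p z powr p = (\<Sum>j<N. lpnorm p (Z j) powr p)"
      unfolding z_def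
    proof (rule lpnorm_sum_disjoint)
      fix i j k
      assume "i \<in> {..<N}" "j \<in> {..<N}" "i \<noteq> j"
      then show "Z i k = 0 \<or> Z j k = 0"
        using f(3)[of i j "rat_pt (fst (prod_decode k))"] by (auto simp: Z_def diag_op_def)
    qed (auto simp: Z)
    have N_powr: "(r * real N powr (1 / p)) powr p = (\<Sum>j<N. r powr p)" if "0 \<le> r" for r
      using that p_gt_1 by (simp add: powr_mult powr_powr)
    have "(3 / 4 * \<alpha> * real N powr (1 / p)) powr p \<le> lpnorm p z powr p"
      unfolding z_powr using \<alpha>(1) p_gt_1 Z_norm(1)
      by (subst N_powr, simp, intro sum_mono powr_mono2) auto
    then have lower: "3 / 4 * \<alpha> * real N powr (1 / p) \<le> lpnorm p z"
      using p_gt_1 powr_less_mono2[of p "lpnorm p z" "3 / 4 * \<alpha> * real N powr (1 / p)"] by force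
    have "lpnorm p z powr p \<le> (2 * \<beta> * real N powr (1 / p)) powr p"
      unfolding z_powr using \<beta>(1) p_gt_1 Z_norm(2)
      by (subst N_powr, simp, intro sum_mono powr_mono2) auto
    then have upper: "lpnorm p z \<le> 2 * \<beta> * real N powr (1 / p)"
      using p_gt_1 \<beta>(1) powr_less_mono2[of p "2 * \<beta> * real N powr (1 / p)" "lpnorm p z"] by force
    \<comment> \<open>Since N >= 1, the additive error \<alpha> / 4 can be absorbed into a multiple
      of N^(1/p).\<close>
    have one: "1 \<le> real N powr (1 / p)"
      using N p_gt_1 by (intro ge_one_powr_ge_zero) auto
    have \<alpha>4: "\<alpha> / 4 \<le> \<alpha> / 4 * real N powr (1 / p)"
      using mult_left_mono[OF one, of "\<alpha> / 4"] \<alpha>(1) by simp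
    have \<beta>4: "\<alpha> / 4 * real N powr (1 / p) \<le> \<beta> * real N powr (1 / p)"
      using \<open>\<alpha> \<le> \<beta>\<close> \<alpha>(1) by (intro mult_right_mono) auto
    have Vx_lp: "V x \<in> lp p"
      by (rule bounded_opD(1)[OF V x])
    have "\<alpha> / 2 * real N powr (1 / p) \<le> lpnorm p (V x)"
      using lower diff \<alpha>4 lpnorm_le_diff_add[OF z Vx_lp] lpnorm_diff_commute[OF Vx_lp z]
      by linarith
    moreover have "lpnorm p (V x) \<le> 3 * \<beta> * real N powr (1 / p)"
      using upper diff \<alpha>4 \<beta>4 lpnorm_le_diff_add[OF Vx_lp z] by linarith
    moreover have "\<alpha> * (c * real N powr (1 / 2)) \<le> lpnorm p (V x)"
      using order_trans[OF mult_left_mono \<alpha>(2)[OF x]] cC[of N "N + n0"] \<alpha>(1) by (simp add: x_def v_def)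
    moreover have "lpnorm p (V x) \<le> \<beta> * (C * real N powr (1 / 2))"
      using order_trans[OF \<beta>(2)[OF x] mult_left_mono] cC[of N "N + n0"] \<beta>(1) by (simp add: x_def v_def)
    ultimately show ?thesis
      by (simp add: mult.assoc)
  qed
  have ratio: "real N powr (a - b) \<le> w / u" if "u * real N powr a \<le> w * real N powr b" "0 < u" "0 < N"
    for u w a b and N :: nat
    using that by (simp add: powr_diff field_simps)
  \<comment> \<open>If p < 2, then N^(1/p) outgrows N^(1/2) and the first inequality of
    \<open>main\<close> fails for large N; if p > 2, the growth is reversed and the second one
    fails.\<close>
  show False
  proof (cases "p < 2")
    case True
    obtain N :: nat where "0 < N" "\<beta> * C / (\<alpha> / 2) < real N powr (1 / p - 1 / 2)"
      using nat_powr_unbounded[of "1 / p - 1 / 2"] True p_gt_1 by (auto simp: field_simps)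
    then show False
      using ratio[of "\<alpha> / 2" N "1 / p" "\<beta> * C" "1 / 2"] main[of N] \<alpha>(1) by simp
  next
    case False
    then obtain N :: nat where "0 < N" "3 * \<beta> / (\<alpha> * c) < real N powr (1 / 2 - 1 / p)"
      using nat_powr_unbounded[of "1 / 2 - 1 / p"] p_gt_1 assms by (auto simp: field_simps)
    then show False
      using ratio[of "\<alpha> * c" N "1 / 2" "3 * \<beta>" "1 / p"] main[of N] \<alpha>(1) c by simp
  qed
qed

end

theorem theorem5p22:
  fixes p :: real
  assumes "1 < p" and "p \<noteq> 2"
  shows "\<exists>\<phi>1 \<phi>2. trivial_ext p \<phi>1 \<and> trivial_ext p \<phi>2 \<and> \<not> ext_equiv p \<phi>1 \<phi>2 \<and>
           (\<forall>\<phi>3. iso_ext p \<phi>3 \<longrightarrow> \<not> ext_equiv p \<phi>1 (ext_sum p \<phi>2 \<phi>3))"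
proof (intro exI conjI allI impI)
  let ?\<rho>1 = "\<lambda>f :: real \<Rightarrow> complex. diag_op (\<lambda>i. f (rat_pt i))"
  let ?\<rho>2 = "\<lambda>f :: real \<Rightarrow> complex. rad_op (\<lambda>i. f (rat_pt i))"
  show "trivial_ext p (\<lambda>f. calkin_pi p (?\<rho>1 f))"
    by (rule trivial_ext_diag[OF assms(1)])
  show "trivial_ext p (\<lambda>f. calkin_pi p (?\<rho>2 f))"
    by (rule trivial_ext_rad[OF assms(1)])
  note bounded = diag_lift_bounded[OF assms(1)] rad_lift_bounded[OF assms(1)]
  show "\<not> ext_equiv p (\<lambda>f. calkin_pi p (?\<rho>1 f)) (\<lambda>f. calkin_pi p (?\<rho>2 f))"
  proof
    assume "ext_equiv p (\<lambda>f. calkin_pi p (?\<rho>1 f)) (\<lambda>f. calkin_pi p (?\<rho>2 f))"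
    then have "\<exists>V. intertwiner p ?\<rho>1 ?\<rho>2 V"
      by (rule ext_equiv_imp_intertwiner[OF assms(1), rotated 2]) (rule bounded, assumption)+
    then show False
      using no_intertwiner[OF assms] by blast
  qed
  fix \<phi>3
  assume \<phi>3: "iso_ext p \<phi>3"
  show "\<not> ext_equiv p (\<lambda>f. calkin_pi p (?\<rho>1 f)) (ext_sum p (\<lambda>f. calkin_pi p (?\<rho>2 f)) \<phi>3)"
  proof
    assume "ext_equiv p (\<lambda>f. calkin_pi p (?\<rho>1 f)) (ext_sum p (\<lambda>f. calkin_pi p (?\<rho>2 f)) \<phi>3)"
    then have "\<exists>V. intertwiner p ?\<rho>1 ?\<rho>2 V"
      by (rule ext_equiv_sum_imp_intertwiner[OF assms(1) _ _ \<phi>3, rotated 2]) (rule bounded, assumption)+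
    then show False
      using no_intertwiner[OF assms] by blast
  qed
qed

end
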